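(* Let $H$ be a quasi-triangular quasi-Hopf algebra with co-associator $\Phi$ and $R$-matrix $\mathcal{R}$, and let $F(\lambda)\in H\otimes H$ be a twist satisfying the shifted quasi-cocycle condition $$F_{12}(\lambda)\cdot(\Delta\otimes 1)F(\lambda)\cdot\Phi=\Phi\cdot F_{23}(\lambda+h^{(1)})\cdot(1\otimes\Delta)F(\lambda).$$ Then $\mathcal{R}(\lambda)=F^T(\lambda)\mathcal{R}F(\lambda)^{-1}$ satisfies the quasi-dynamical QYBE $$\mathcal{R}_{12}(\lambda+h^{(3)})\cdot\Phi^{-1}_{231}\cdot\mathcal{R}_{13}(\lambda)\cdot\Phi_{132}\cdot\mathcal{R}_{23}(\lambda+h^{(1)})\cdot\Phi^{-1}_{123}=\Phi^{-1}_{321}\cdot\mathcal{R}_{23}(\lambda)\cdot\Phi_{312}\cdot\mathcal{R}_{13}(\lambda+h^{(2)})\cdot\Phi^{-1}_{213}\cdot\mathcal{R}_{12}(\lambda).$$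
   Context: A quasi-bialgebra $(H,\Delta,\epsilon,\Phi)$ over a field $k$ is a unital associative $k$-algebra $H$ with algebra homomorphisms $\epsilon:H\to k$, $\Delta:H\to H\otimes H$ and an invertible $\Phi\in H\otimes H\otimes H$ such that (with $1$ also denoting the identity map) $(1\otimes\Delta)\Delta(a)=\Phi^{-1}(\Delta\otimes 1)\Delta(a)\Phi$ for all $a\in H$; $(\Delta\otimes 1\otimes 1)\Phi\cdot(1\otimes 1\otimes\Delta)\Phi=(\Phi\otimes 1)\cdot(1\otimes\Delta\otimes 1)\Phi\cdot(1\otimes\Phi)$; $(\epsilon\otimes 1)\Delta=1=(1\otimes\epsilon)\Delta$; $(1\otimes\epsilon\otimes 1)\Phi=1$. Write $\Phi=\sum_\nu X_\nu\otimes Y_\nu\otimes Z_\nu$, $\Phi^{-1}=\sum_\nu\bar X_\nu\otimes\bar Y_\nu\otimes\bar Z_\nu$, $\Delta(a)=\sum a_{(1)}\otimes a_{(2)}$. A quasi-Hopf algebra is a quasi-bialgebra with a bijective algebra anti-homomorphism $S:H\to H$ and $\alpha,\beta\in H$ such that $\sum S(X_\nu)\alpha Y_\nu\beta S(Z_\nu)=1=\sum\bar X_\nu\beta S(\bar Y_\nu)\alpha\bar Z_\nu$ and $\sum S(a_{(1)})\alpha a_{(2)}=\epsilon(a)\alpha$, $\sum a_{(1)}\beta S(a_{(2)})=\epsilon(a)\beta$ for all $a\in H$. It is quasi-triangular if there is an invertible $\mathcal{R}\in H\otimes H$ (the $R$-matrix) with $\Delta^T(a)\mathcal{R}=\mathcal{R}\Delta(a)$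 for all $a$, $(\Delta\otimes 1)\mathcal{R}=\Phi_{231}^{-1}\mathcal{R}_{13}\Phi_{132}\mathcal{R}_{23}\Phi_{123}^{-1}$, $(1\otimes\Delta)\mathcal{R}=\Phi_{312}\mathcal{R}_{13}\Phi_{213}^{-1}\mathcal{R}_{12}\Phi_{123}$. Here $T$ is the flip, $\Delta^T=T\circ\Delta$, $F^T=T(F)$; for $A=\sum a_i\otimes a^i\in H\otimes H$, $A_{12}=\sum a_i\otimes a^i\otimes 1$, $A_{13}=\sum a_i\otimes 1\otimes a^i$, $A_{23}=\sum 1\otimes a_i\otimes a^i$; and $\Phi_{123}=\Phi$, $\Phi_{132}=\sum X_\nu\otimes Z_\nu\otimes Y_\nu$, $\Phi_{213}=\sum Y_\nu\otimes X_\nu\otimes Z_\nu$, $\Phi_{231}=\sum Y_\nu\otimes Z_\nu\otimes X_\nu$, $\Phi_{312}=\sum Z_\nu\otimes X_\nu\otimes Y_\nu$, $\Phi_{321}=\sum Z_\nu\otimes Y_\nu\otimes X_\nu$. A twist is an invertible $F\in H\otimes H$ with $(\epsilon\otimes 1)F=(1\otimes\epsilon)F=1$. Here the twist $F(\lambda)$ depends on $\lambda\in H$, where $\lambda$ depends on one or several parameters, and $h\in H$ is fixed. Shift notation: $F_{23}(\lambda+h^{(1)})=1\otimes F(\lambda+h^{(1)})$ denotes the invertible element of $H\otimes H\otimes H$ obtained from $F_{23}(\lambda)$ by shifting the argument $\lambda$ by $h$ placed in the first tensor factor; shifting the argument is compatible with products and inverses and leaves $\lambda$-independent elements unchanged,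 so that, with $F^T_{23}(\lambda+h^{(1)})=(1\otimes T)F_{23}(\lambda+h^{(1)})$, one has $\mathcal{R}_{23}(\lambda+h^{(1)})=F^T_{23}(\lambda+h^{(1)})\,\mathcal{R}_{23}\,F_{23}(\lambda+h^{(1)})^{-1}$. The other shifted elements are obtained by permuting tensor factors: $F_{13}(\lambda+h^{(2)})=(T\otimes 1)F_{23}(\lambda+h^{(1)})$, $\mathcal{R}_{13}(\lambda+h^{(2)})=(T\otimes 1)\mathcal{R}_{23}(\lambda+h^{(1)})$, $\mathcal{R}_{12}(\lambda+h^{(3)})=(1\otimes T)\mathcal{R}_{13}(\lambda+h^{(2)})$. *)

theory Defs
  imports Complex_Main "HOL-Algebra.Module" "HOL-Library.Poly_Mapping"
begin

section \<open>Tensor powers of an algebra\<close>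

text \<open>
  Throughout, \<open>scale\<close> is the scalar multiplication of a unital associative algebra on the type
  \<open>'h\<close> over the field \<open>'k\<close>.  Since a type cannot depend on \<open>scale\<close>, the tensor powers are
  built as carrier sets.  The \<open>n\<close>-fold tensor power is the textbook quotient: the vector space
  freely generated by the \<open>n\<close>-tuples over \<open>'h\<close> (lists of length \<open>n\<close>), modulo the span of the
  multilinearity relations.  Its elements are the cosets.  The flat \<open>n\<close>-fold power is used,
  so the associativity isomorphisms of iterated tensor products are identities.
\<close>

locale unital_algebra = vector_space scale
  for scale :: "'k::field \<Rightarrow> 'h::ring_1 \<Rightarrow> 'h" +
  assumes scale_mult_left: "scale c (x * y) = scale c x * y"
    and scale_mult_right: "scale c (x * y) = x * scale c y"

type_synonym ('k, 'h) formal_sum = "'h list \<Rightarrow>\<^sub>0 'k"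
type_synonym ('k, 'h) tensor = "('k, 'h) formal_sum set"

abbreviation formal :: "'h list \<Rightarrow> ('k::field, 'h) formal_sum"
  where "formal xs \<equiv> Poly_Mapping.single xs 1"

definition formal_scale :: "'k::field \<Rightarrow> ('k, 'h) formal_sum \<Rightarrow> ('k, 'h) formal_sum"
  where "formal_scale c u = Poly_Mapping.map ((*) c) u"

text \<open>Linear extension of \<open>f\<close> from generators to formal sums, for a target with scalar
  multiplication \<open>sc\<close>.\<close>

definition lin_ext ::
    "('k::field \<Rightarrow> 'v \<Rightarrow> 'v::comm_monoid_add) \<Rightarrow> ('h list \<Rightarrow> 'v) \<Rightarrow> ('k, 'h) formal_sum \<Rightarrow> 'v"
  where "lin_ext sc f u = (\<Sum>xs\<in>Poly_Mapping.keys u. sc (Poly_Mapping.lookup u xs) (f xs))"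

definition multilinear_relations ::
    "('k::field \<Rightarrow> 'h::ring_1 \<Rightarrow> 'h) \<Rightarrow> nat \<Rightarrow> ('k, 'h) formal_sum set"
  where "multilinear_relations scale n =
    {formal (xs[i := a + b]) - formal (xs[i := a]) - formal (xs[i := b]) | xs i a b.
       length xs = n \<and> i < n} \<union>
    {formal (xs[i := scale c a]) - formal_scale c (formal (xs[i := a])) | xs i c a.
       length xs = n \<and> i < n}"

definition tensor_class ::
    "('k::field \<Rightarrow> 'h::ring_1 \<Rightarrow> 'h) \<Rightarrow> nat \<Rightarrow> ('k, 'h) formal_sum \<Rightarrow> ('k, 'h) tensor"
  where "tensor_class scale n u =
    {v. v - u \<in> Modules.module.span formal_scale (multilinear_relations scale n)}"

text \<open>
  An arbitrary presentation of a tensor as a formal sum of tuples, as in the notation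
  \<open>\<Phi> = \<Sum> X \<otimes> Y \<otimes> Z\<close>.  It is only used in expressions that are multilinear in the
  entries of the tuples, whose value does not depend on the choice.
\<close>

definition tensor_rep :: "('k, 'h) tensor \<Rightarrow> ('k, 'h) formal_sum"
  where "tensor_rep A = (SOME u. u \<in> A)"

text \<open>
  The algebra \<open>H \<otimes> \<dots> \<otimes> H\<close> (\<open>n\<close> factors) with componentwise product.  In the record
  notation of HOL-Algebra, \<open>A \<otimes>\<^bsub>tensor_power scale n\<^esub> B\<close> is the \<^emph>\<open>product\<close> of two
  elements of this algebra, not their tensor product.
\<close>

definition tensor_power ::
    "('k::field \<Rightarrow> 'h::ring_1 \<Rightarrow> 'h) \<Rightarrow> nat \<Rightarrow> ('k, ('k, 'h) tensor) module"
  where "tensor_power scale n =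
    \<lparr>carrier = {tensor_class scale n u | u. Poly_Mapping.keys u \<subseteq> {xs. length xs = n}},
     mult = (\<lambda>A B. tensor_class scale n
       (lin_ext formal_scale (\<lambda>xs. lin_ext formal_scale (\<lambda>ys. formal (map2 (*) xs ys))
          (tensor_rep B)) (tensor_rep A))),
     one = tensor_class scale n (formal (replicate n 1)),
     zero = tensor_class scale n 0,
     add = (\<lambda>A B. tensor_class scale n (tensor_rep A + tensor_rep B)),
     smult = (\<lambda>c A. tensor_class scale n (formal_scale c (tensor_rep A)))\<rparr>"

subsection \<open>Maps between tensor powers\<close>

text \<open>\<open>tensor_eval scale f A = \<Sum> f [a, b, \<dots>]\<close> for \<open>A = \<Sum> a \<otimes> b \<otimes> \<dots>\<close> and \<open>f\<close>
  multilinear.\<close>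

definition tensor_eval ::
    "('k::field \<Rightarrow> 'h::ring_1 \<Rightarrow> 'h) \<Rightarrow> ('h list \<Rightarrow> 'h) \<Rightarrow> ('k, 'h) tensor \<Rightarrow> 'h"
  where "tensor_eval scale f A = lin_ext scale f (tensor_rep A)"

text \<open>The linear map into the \<open>n\<close>-fold power sending a pure tensor with entries \<open>xs\<close> to the
  one with entries \<open>g xs\<close>.\<close>

definition tensor_map ::
    "('k::field \<Rightarrow> 'h::ring_1 \<Rightarrow> 'h) \<Rightarrow> nat \<Rightarrow> ('h list \<Rightarrow> 'h list) \<Rightarrow>
     ('k, 'h) tensor \<Rightarrow> ('k, 'h) tensor"
  where "tensor_map scale n g A =
    tensor_class scale n (lin_ext formal_scale (\<lambda>xs. formal (g xs)) (tensor_rep A))"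

text \<open>Permutation of tensor factors, with the factors numbered from 1:
  \<open>perm scale [3, 1, 2]\<close> sends \<open>X \<otimes> Y \<otimes> Z\<close> to \<open>Z \<otimes> X \<otimes> Y\<close>.\<close>

definition perm ::
    "('k::field \<Rightarrow> 'h::ring_1 \<Rightarrow> 'h) \<Rightarrow> nat list \<Rightarrow> ('k, 'h) tensor \<Rightarrow> ('k, 'h) tensor"
  where "perm scale p A = tensor_map scale (length p) (\<lambda>xs. map (\<lambda>i. xs ! (i - 1)) p) A"

definition leg12 ::
    "('k::field \<Rightarrow> 'h::ring_1 \<Rightarrow> 'h) \<Rightarrow> ('k, 'h) tensor \<Rightarrow> ('k, 'h) tensor"
  where "leg12 scale A = tensor_map scale 3 (\<lambda>xs. [xs ! 0, xs ! 1, 1]) A"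

definition leg13 ::
    "('k::field \<Rightarrow> 'h::ring_1 \<Rightarrow> 'h) \<Rightarrow> ('k, 'h) tensor \<Rightarrow> ('k, 'h) tensor"
  where "leg13 scale A = tensor_map scale 3 (\<lambda>xs. [xs ! 0, 1, xs ! 1]) A"

definition leg23 ::
    "('k::field \<Rightarrow> 'h::ring_1 \<Rightarrow> 'h) \<Rightarrow> ('k, 'h) tensor \<Rightarrow> ('k, 'h) tensor"
  where "leg23 scale A = tensor_map scale 3 (\<lambda>xs. [1, xs ! 0, xs ! 1]) A"

text \<open>
  \<open>1 \<otimes> \<dots> \<otimes> D \<otimes> \<dots> \<otimes> 1\<close> with the linear map \<open>D\<close> from \<open>H\<close> to \<open>H \<otimes> H\<close> acting on the
  \<open>i\<close>-th factor (numbered from 1) of an element of the \<open>n\<close>-fold power; the result lies in the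
  \<open>(n + 1)\<close>-fold power.
\<close>

definition apply_at ::
    "('k::field \<Rightarrow> 'h::ring_1 \<Rightarrow> 'h) \<Rightarrow> nat \<Rightarrow> nat \<Rightarrow> ('h \<Rightarrow> ('k, 'h) tensor) \<Rightarrow>
     ('k, 'h) tensor \<Rightarrow> ('k, 'h) tensor"
  where "apply_at scale n i D A = tensor_class scale (Suc n)
    (lin_ext formal_scale
       (\<lambda>xs. lin_ext formal_scale (\<lambda>ds. formal (take (i - 1) xs @ ds @ drop i xs))
          (tensor_rep (D (xs ! (i - 1)))))
       (tensor_rep A))"


section \<open>Quasi-triangular quasi-Hopf algebras\<close>

locale quasi_bialgebra = unital_algebra scale
  for scale :: "'k::field \<Rightarrow> 'h::ring_1 \<Rightarrow> 'h" +
  fixes \<Delta> :: "'h \<Rightarrow> ('k, 'h) tensor"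
    and \<epsilon> :: "'h \<Rightarrow> 'k"
    and \<Phi> :: "('k, 'h) tensor"
  assumes counit_linear: "Vector_Spaces.linear scale (*) \<epsilon>"
    and counit_mult: "\<epsilon> (a * b) = \<epsilon> a * \<epsilon> b"
    and counit_one: "\<epsilon> 1 = 1"
    and comult_closed: "\<Delta> a \<in> carrier (tensor_power scale 2)"
    and comult_add: "\<Delta> (a + b) = \<Delta> a \<oplus>\<^bsub>tensor_power scale 2\<^esub> \<Delta> b"
    and comult_scale: "\<Delta> (scale c a) = c \<odot>\<^bsub>tensor_power scale 2\<^esub> \<Delta> a"
    and comult_mult: "\<Delta> (a * b) = \<Delta> a \<otimes>\<^bsub>tensor_power scale 2\<^esub> \<Delta> b"
    and comult_one: "\<Delta> 1 = \<one>\<^bsub>tensor_power scale 2\<^esub>"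
    and coassociator_invertible: "\<Phi> \<in> Units (tensor_power scale 3)"
    and quasi_coassoc:
      "apply_at scale 2 2 \<Delta> (\<Delta> a) =
         inv\<^bsub>tensor_power scale 3\<^esub> \<Phi> \<otimes>\<^bsub>tensor_power scale 3\<^esub>
         apply_at scale 2 1 \<Delta> (\<Delta> a) \<otimes>\<^bsub>tensor_power scale 3\<^esub> \<Phi>"
    and pentagon:
      "apply_at scale 3 1 \<Delta> \<Phi> \<otimes>\<^bsub>tensor_power scale 4\<^esub> apply_at scale 3 3 \<Delta> \<Phi> =
         tensor_map scale 4 (\<lambda>xs. xs @ [1]) \<Phi> \<otimes>\<^bsub>tensor_power scale 4\<^esub>
         apply_at scale 3 2 \<Delta> \<Phi> \<otimes>\<^bsub>tensor_power scale 4\<^esub>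
         tensor_map scale 4 (\<lambda>xs. 1 # xs) \<Phi>"
    and counit_left: "tensor_eval scale (\<lambda>xs. scale (\<epsilon> (xs ! 0)) (xs ! 1)) (\<Delta> a) = a"
    and counit_right: "tensor_eval scale (\<lambda>xs. scale (\<epsilon> (xs ! 1)) (xs ! 0)) (\<Delta> a) = a"
    and coassociator_counit:
      "tensor_map scale 2 (\<lambda>xs. [xs ! 0, scale (\<epsilon> (xs ! 1)) (xs ! 2)]) \<Phi> =
         \<one>\<^bsub>tensor_power scale 2\<^esub>"

locale quasi_hopf_algebra = quasi_bialgebra scale \<Delta> \<epsilon> \<Phi>
  for scale :: "'k::field \<Rightarrow> 'h::ring_1 \<Rightarrow> 'h" and \<Delta> \<epsilon> \<Phi> +
  fixes S :: "'h \<Rightarrow> 'h" and \<alpha> \<beta> :: 'h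
  assumes antipode_linear: "Vector_Spaces.linear scale scale S"
    and antipode_mult: "S (a * b) = S b * S a"
    and antipode_one: "S 1 = 1"
    and antipode_bij: "bij S"
    and antipode_coassociator:
      "tensor_eval scale (\<lambda>xs. S (xs ! 0) * \<alpha> * (xs ! 1) * \<beta> * S (xs ! 2)) \<Phi> = 1"
    and antipode_coassociator_inv:
      "tensor_eval scale (\<lambda>xs. (xs ! 0) * \<beta> * S (xs ! 1) * \<alpha> * (xs ! 2))
         (inv\<^bsub>tensor_power scale 3\<^esub> \<Phi>) = 1"
    and antipode_alpha:
      "tensor_eval scale (\<lambda>xs. S (xs ! 0) * \<alpha> * (xs ! 1)) (\<Delta> a) = scale (\<epsilon> a) \<alpha>"
    and antipode_beta:
      "tensor_eval scale (\<lambda>xs. (xs ! 0) * \<beta> * S (xs ! 1)) (\<Delta> a) = scale (\<epsilon> a) \<beta>"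

locale quasi_triangular_quasi_hopf_algebra = quasi_hopf_algebra scale \<Delta> \<epsilon> \<Phi> S \<alpha> \<beta>
  for scale :: "'k::field \<Rightarrow> 'h::ring_1 \<Rightarrow> 'h" and \<Delta> \<epsilon> \<Phi> S \<alpha> \<beta> +
  fixes \<R> :: "('k, 'h) tensor"
  assumes R_invertible: "\<R> \<in> Units (tensor_power scale 2)"
    and R_comult:
      "perm scale [2, 1] (\<Delta> a) \<otimes>\<^bsub>tensor_power scale 2\<^esub> \<R> =
         \<R> \<otimes>\<^bsub>tensor_power scale 2\<^esub> \<Delta> a"
    and R_hexagon_left:
      "apply_at scale 2 1 \<Delta> \<R> =
         inv\<^bsub>tensor_power scale 3\<^esub> (perm scale [2, 3, 1] \<Phi>) \<otimes>\<^bsub>tensor_power scale 3\<^esub>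
         leg13 scale \<R> \<otimes>\<^bsub>tensor_power scale 3\<^esub>
         perm scale [1, 3, 2] \<Phi> \<otimes>\<^bsub>tensor_power scale 3\<^esub>
         leg23 scale \<R> \<otimes>\<^bsub>tensor_power scale 3\<^esub>
         inv\<^bsub>tensor_power scale 3\<^esub> \<Phi>"
    and R_hexagon_right:
      "apply_at scale 2 2 \<Delta> \<R> =
         perm scale [3, 1, 2] \<Phi> \<otimes>\<^bsub>tensor_power scale 3\<^esub>
         leg13 scale \<R> \<otimes>\<^bsub>tensor_power scale 3\<^esub>
         inv\<^bsub>tensor_power scale 3\<^esub> (perm scale [2, 1, 3] \<Phi>) \<otimes>\<^bsub>tensor_power scale 3\<^esub>
         leg12 scale \<R> \<otimes>\<^bsub>tensor_power scale 3\<^esub> \<Phi>"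

definition is_twist ::
    "('k::field \<Rightarrow> 'h::ring_1 \<Rightarrow> 'h) \<Rightarrow> ('h \<Rightarrow> 'k) \<Rightarrow> ('k, 'h) tensor \<Rightarrow> bool"
  where "is_twist scale \<epsilon> F \<longleftrightarrow>
    F \<in> Units (tensor_power scale 2) \<and>
    tensor_eval scale (\<lambda>xs. scale (\<epsilon> (xs ! 0)) (xs ! 1)) F = 1 \<and>
    tensor_eval scale (\<lambda>xs. scale (\<epsilon> (xs ! 1)) (xs ! 0)) F = 1"


section \<open>Shifting the argument\<close>

text \<open>
  \<open>D\<close> is the set of values in \<open>'h\<close> that the argument takes as its parameters vary,
  and \<open>\<A>\<close> is the set of those argument-dependent elements of \<open>H \<otimes> H\<close> (for instance rational
  or meromorphic ones) whose argument can be shifted.  If \<open>f \<in> \<A>\<close>, then \<open>shift h f l\<close> is the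
  element of \<open>H \<otimes> H \<otimes> H\<close> usually written as \<open>f\<close> with subscript 23 at \<open>l + h\<close>, with \<open>h\<close> placed
  in the first tensor factor.  How the substitution is carried out depends on the nature of the
  dependence on the argument (evaluation on weight spaces, power series, \<dots>); the locale
  records only the rules it obeys.  Values of families outside \<open>D\<close> are irrelevant.
\<close>

locale argument_shift = unital_algebra scale
  for scale :: "'k::field \<Rightarrow> 'h::ring_1 \<Rightarrow> 'h" +
  fixes h :: 'h
    and D :: "'h set"
    and \<A> :: "('h \<Rightarrow> ('k, 'h) tensor) set"
    and shift :: "'h \<Rightarrow> ('h \<Rightarrow> ('k, 'h) tensor) \<Rightarrow> 'h \<Rightarrow> ('k, 'h) tensor"
  assumes family_closed:
      "\<lbrakk>f \<in> \<A>; l \<in> D\<rbrakk> \<Longrightarrow> f l \<in> carrier (tensor_power scale 2)"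
    and shift_closed:
      "\<lbrakk>f \<in> \<A>; l \<in> D\<rbrakk> \<Longrightarrow> shift h f l \<in> carrier (tensor_power scale 3)"
    and const_family:
      "A \<in> carrier (tensor_power scale 2) \<Longrightarrow> (\<lambda>_. A) \<in> \<A>"
    and shift_const:
      "\<lbrakk>A \<in> carrier (tensor_power scale 2); l \<in> D\<rbrakk> \<Longrightarrow> shift h (\<lambda>_. A) l = leg23 scale A"
    and mult_family:
      "\<lbrakk>f \<in> \<A>; g \<in> \<A>\<rbrakk> \<Longrightarrow> (\<lambda>l. f l \<otimes>\<^bsub>tensor_power scale 2\<^esub> g l) \<in> \<A>"
    and shift_mult:
      "\<lbrakk>f \<in> \<A>; g \<in> \<A>; l \<in> D\<rbrakk> \<Longrightarrow>
        shift h (\<lambda>l. f l \<otimes>\<^bsub>tensor_power scale 2\<^esub> g l) l =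
          shift h f l \<otimes>\<^bsub>tensor_power scale 3\<^esub> shift h g l"
    and shift_inv:
      "\<lbrakk>f \<in> \<A>; \<And>l. l \<in> D \<Longrightarrow> f l \<in> Units (tensor_power scale 2);
        (\<lambda>l. inv\<^bsub>tensor_power scale 2\<^esub> (f l)) \<in> \<A>; l \<in> D\<rbrakk> \<Longrightarrow>
        shift h f l \<in> Units (tensor_power scale 3) \<and>
        shift h (\<lambda>l. inv\<^bsub>tensor_power scale 2\<^esub> (f l)) l =
          inv\<^bsub>tensor_power scale 3\<^esub> (shift h f l)"
    and flip_family:
      "f \<in> \<A> \<Longrightarrow> (\<lambda>l. perm scale [2, 1] (f l)) \<in> \<A>"
    and shift_flip:
      "\<lbrakk>f \<in> \<A>; l \<in> D\<rbrakk> \<Longrightarrow>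
        shift h (\<lambda>l. perm scale [2, 1] (f l)) l = perm scale [1, 3, 2] (shift h f l)"

definition twisted_R ::
    "('k::field \<Rightarrow> 'h::ring_1 \<Rightarrow> 'h) \<Rightarrow> ('k, 'h) tensor \<Rightarrow> ('h \<Rightarrow> ('k, 'h) tensor) \<Rightarrow>
     'h \<Rightarrow> ('k, 'h) tensor"
  where "twisted_R scale \<R> F l =
    perm scale [2, 1] (F l) \<otimes>\<^bsub>tensor_power scale 2\<^esub> \<R> \<otimes>\<^bsub>tensor_power scale 2\<^esub>
    inv\<^bsub>tensor_power scale 2\<^esub> (F l)"

text \<open>
  For \<open>A\<close> an argument-dependent element of \<open>H \<otimes> H\<close>: the element with subscript 13 and the
  shift placed in the second factor, and the one with subscript 12 and the shift placed in the
  third factor.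
\<close>

definition shifted13 ::
    "('k::field \<Rightarrow> 'h::ring_1 \<Rightarrow> 'h) \<Rightarrow>
     ('h \<Rightarrow> ('h \<Rightarrow> ('k, 'h) tensor) \<Rightarrow> 'h \<Rightarrow> ('k, 'h) tensor) \<Rightarrow>
     'h \<Rightarrow> ('h \<Rightarrow> ('k, 'h) tensor) \<Rightarrow> 'h \<Rightarrow> ('k, 'h) tensor"
  where "shifted13 scale shift h A l = perm scale [2, 1, 3] (shift h A l)"

definition shifted12 ::
    "('k::field \<Rightarrow> 'h::ring_1 \<Rightarrow> 'h) \<Rightarrow>
     ('h \<Rightarrow> ('h \<Rightarrow> ('k, 'h) tensor) \<Rightarrow> 'h \<Rightarrow> ('k, 'h) tensor) \<Rightarrow>
     'h \<Rightarrow> ('h \<Rightarrow> ('k, 'h) tensor) \<Rightarrow> 'h \<Rightarrow> ('k, 'h) tensor"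
  where "shifted12 scale shift h A l = perm scale [1, 3, 2] (shifted13 scale shift h A l)"

end

theory Submission
  imports Defs
begin

text \<open>
  Write \<open>A = (\<Delta> \<otimes> 1)F\<close>, \<open>B = (1 \<otimes> \<Delta>)F\<close> and \<open>G\<close> for the shifted twist with subscript 23, and set
  \<open>L = F\<^sub>1\<^sub>2 A\<close> and \<open>K = G B\<close>: these are the threefold twists belonging to the left and to the right
  bracketing of \<open>H \<otimes> H \<otimes> H\<close>.  The shifted cocycle condition says \<open>L \<Phi> = \<Phi> K\<close>, so it is the
  statement \<open>\<Phi> = L \<Phi> K\<inverse>\<close> that the coassociator is unchanged when its source is twisted by \<open>K\<close> and
  its target by \<open>L\<close>.

  The twisted \<open>R\<close>-matrices are gauge transformed in the same way.  Since \<open>\<R>\<close> intertwines \<open>\<Delta>\<close> with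
  the opposite coproduct, \<open>\<R>\<^sub>1\<^sub>2 A = A\<^sub>2\<^sub>1\<^sub>3 \<R>\<^sub>1\<^sub>2\<close>, and the factor \<open>A\<close> can be inserted into
  \<open>\<R>\<^sub>1\<^sub>2(\<lambda>) = F\<^sub>2\<^sub>1 \<R>\<^sub>1\<^sub>2 F\<^sub>1\<^sub>2\<inverse>\<close>, giving \<open>\<R>\<^sub>1\<^sub>2(\<lambda>) = L\<^sub>2\<^sub>1\<^sub>3 \<R>\<^sub>1\<^sub>2 L\<inverse>\<close>; likewise
  \<open>\<R>\<^sub>2\<^sub>3(\<lambda> + h\<^sup>(\<^sup>1\<^sup>)) = K\<^sub>1\<^sub>3\<^sub>2 \<R>\<^sub>2\<^sub>3 K\<inverse>\<close>.  All other factors of the two sides arise from these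
  three by permuting tensor factors and inverting.  In the products of the equation neighbouring gauge
  factors cancel, so both sides are their untwisted counterparts multiplied by \<open>K\<^sub>3\<^sub>2\<^sub>1\<close> on the left and by \<open>L\<inverse>\<close> on the
  right.  What remains is the quasi-Yang--Baxter equation for \<open>\<R>\<close>, which is \<open>\<R>\<^sub>1\<^sub>2\<close> moved through the
  hexagon formula for \<open>(\<Delta> \<otimes> 1)\<R>\<close> (\<open>quasi_yang_baxter\<close>, \<open>dynamical_yang_baxter\<close>).

  The rest of the work makes the tensor calculus available.  Computations take place in the space of
  formal sums of tuples, where componentwise multiplication is already associative and where
  relabellings of tensor factors are already multiplicative.  They descend to the tensor powers because
  all maps involved preserve the span of the multilinearity relations.  Only the maps that insert
  \<open>\<Delta>\<close>, defined through chosen representatives of \<open>\<Delta> a\<close>, satisfy their identities merely modulo the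
  relations (\<open>apply_at_hom\<close>, \<open>R_comult_at\<close>).
\<close>

section \<open>Linear algebra of formal sums\<close>

lemma lookup_formal_scale: "Poly_Mapping.lookup (formal_scale c u) xs = c * Poly_Mapping.lookup u xs"
  unfolding formal_scale_def by (simp add: Poly_Mapping.map.rep_eq when_def)

global_interpretation formal: vector_space "formal_scale :: 'k::field \<Rightarrow> ('k, 'h) formal_sum \<Rightarrow> _"
  by unfold_locales
    (rule poly_mapping_eqI; simp add: lookup_formal_scale lookup_add algebra_simps)+

context vector_space
begin

lemma lin_ext_over_superset:
  assumes "finite X" "Poly_Mapping.keys u \<subseteq> X"
  shows "lin_ext scale f u = (\<Sum>xs\<in>X. Poly_Mapping.lookup u xs *s f xs)"
  unfolding lin_ext_def using assms
  by (intro sum.mono_neutral_left) (auto simp: in_keys_iff)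

lemma lin_ext_zero [simp]: "lin_ext scale f 0 = 0"
  by (simp add: lin_ext_def)

lemma lin_ext_add [simp]: "lin_ext scale f (u + v) = lin_ext scale f u + lin_ext scale f v"
proof -
  let ?X = "Poly_Mapping.keys u \<union> Poly_Mapping.keys v"
  have "finite ?X" "Poly_Mapping.keys (u + v) \<subseteq> ?X"
    using keys_add[of u v] by auto
  then show ?thesis
    by (simp add: lin_ext_over_superset[of ?X] lookup_add scale_left_distrib sum.distrib)
qed

lemma lin_ext_scale [simp]: "lin_ext scale f (formal_scale c u) = c *s lin_ext scale f u"
proof -
  have "Poly_Mapping.keys (formal_scale c u) \<subseteq> Poly_Mapping.keys u"
    by (auto simp: in_keys_iff lookup_formal_scale)
  then show ?thesis
    by (simp add: lin_ext_over_superset[of "Poly_Mapping.keys u"] lookup_formal_scale scale_sum_right)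
qed

lemma lin_ext_diff [simp]: "lin_ext scale f (u - v) = lin_ext scale f u - lin_ext scale f v"
  using lin_ext_add[of f "u - v" v] by (simp add: algebra_simps del: lin_ext_add)

lemma lin_ext_formal [simp]: "lin_ext scale f (formal xs) = f xs"
  by (simp add: lin_ext_def)

lemma lin_ext_fun_add: "lin_ext scale (\<lambda>xs. f xs + g xs) u = lin_ext scale f u + lin_ext scale g u"
  by (simp add: lin_ext_def scale_right_distrib sum.distrib)

lemma lin_ext_fun_diff: "lin_ext scale (\<lambda>xs. f xs - g xs) u = lin_ext scale f u - lin_ext scale g u"
  by (simp add: lin_ext_def scale_right_diff_distrib sum_subtractf)

lemma lin_ext_fun_scale: "lin_ext scale (\<lambda>xs. c *s f xs) u = c *s lin_ext scale f u"
  by (simp add: lin_ext_def scale_sum_right mult.commute)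

lemma lin_ext_fun_zero [simp]: "lin_ext scale (\<lambda>xs. 0) u = 0"
  by (simp add: lin_ext_def)

end

abbreviation lin :: "('h list \<Rightarrow> ('k::field, 'h) formal_sum) \<Rightarrow> ('k, 'h) formal_sum \<Rightarrow> ('k, 'h) formal_sum"
  where "lin \<equiv> lin_ext formal_scale"

text \<open>
  The formal sums of tuples of length \<open>n\<close>; elements of the \<open>n\<close>-fold tensor power are represented by
  these, and several identities hold only on tuples of the correct length.
\<close>

definition formal_degree :: "nat \<Rightarrow> ('k::field, 'h) formal_sum set"
  where "formal_degree n = {u. Poly_Mapping.keys u \<subseteq> {xs. length xs = n}}"

lemma formal_degree_iff: "u \<in> formal_degree n \<longleftrightarrow> (\<forall>xs. Poly_Mapping.lookup u xs \<noteq> 0 \<longrightarrow> length xs = n)"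
  by (auto simp: formal_degree_def in_keys_iff)

lemma formal_degree_subspace: "formal.subspace (formal_degree n)"
proof (rule formal.subspaceI)
  show "u + v \<in> formal_degree n" if "u \<in> formal_degree n" "v \<in> formal_degree n"
    for u v :: "('k::field, 'h) formal_sum"
    using that unfolding formal_degree_iff lookup_add by (metis add.right_neutral)
qed (simp_all add: formal_degree_iff lookup_formal_scale)

lemmas formal_degree_closed =
  formal.subspace_0[OF formal_degree_subspace] formal.subspace_add[OF formal_degree_subspace]
  formal.subspace_diff[OF formal_degree_subspace] formal.subspace_scale[OF formal_degree_subspace]

lemma formal_in_degree [simp]: "(formal xs :: ('k::field, 'h) formal_sum) \<in> formal_degree n \<longleftrightarrow> length xs = n"
  by (simp add: formal_degree_def)

lemma formal_expansion: "u = lin formal u"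
proof (rule poly_mapping_eqI)
  fix xs
  have "Poly_Mapping.lookup (lin formal u) xs =
      (\<Sum>ys\<in>Poly_Mapping.keys u. if ys = xs then Poly_Mapping.lookup u ys else 0)"
    unfolding lin_ext_def lookup_sum
    by (intro sum.cong refl) (simp add: lookup_formal_scale lookup_single when_def)
  then show "Poly_Mapping.lookup u xs = Poly_Mapping.lookup (lin formal u) xs"
    by (simp add: in_keys_iff)
qed

lemma formal_in_span_keys: "u \<in> formal.span (formal ` Poly_Mapping.keys u)"
proof -
  have "lin formal u \<in> formal.span (formal ` Poly_Mapping.keys u)"
    unfolding lin_ext_def by (rule formal.span_sum, rule formal.span_scale, rule formal.span_base) simp
  then show ?thesis by (simp flip: formal_expansion)
qed

text \<open>
  The principle by which identities between linear expressions are reduced to single tuples.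
\<close>

lemma formal_degree_induct [consumes 1, case_names zero step]:
  assumes "u \<in> formal_degree n" "P 0"
    and "\<And>c xs u. \<lbrakk>length xs = n; u \<in> formal_degree n; P u\<rbrakk> \<Longrightarrow> P (formal_scale c (formal xs) + u)"
  shows "P u"
proof -
  have "u \<in> formal.span (formal ` {xs. length xs = n})"
    using formal.span_mono[of "formal ` Poly_Mapping.keys u" "formal ` {xs. length xs = n}"]
      formal_in_span_keys[of u] assms(1) by (auto simp: formal_degree_def)
  then have "u \<in> formal_degree n \<and> P u"
  proof (induction rule: formal.span_induct_alt)
    case base
    then show ?case using assms(2) formal_degree_closed(1) by blast
  next
    case (step c x y)
    then obtain xs where "x = formal xs" "length xs = n" by auto
    with step show ?case
      using assms(3)[of xs y c] by (simp add: formal_degree_closed)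
  qed
  then show ?thesis ..
qed

lemma lin_in_degree:
  assumes "u \<in> formal_degree n" "\<And>xs. length xs = n \<Longrightarrow> f xs \<in> formal_degree m"
  shows "lin f u \<in> formal_degree m"
  using assms(1)
  by (induction rule: formal_degree_induct)
    (simp_all add: formal_degree_closed assms(2))

lemma lin_cong:
  assumes "u \<in> formal_degree n" "\<And>xs. length xs = n \<Longrightarrow> f xs = g xs"
  shows "lin f u = lin g u"
  using assms unfolding lin_ext_def formal_degree_def by (intro sum.cong) auto

lemma lin_lin:
  "lin f (lin g u) = lin (\<lambda>xs. lin f (g xs)) u"
proof -
  show ?thesis
    using formal_in_span_keys[of u]
    by (induction rule: formal.span_induct_alt) auto
qed

section \<open>Componentwise multiplication of formal sums\<close>

definition formal_mult :: "('k::field, 'h::ring_1) formal_sum \<Rightarrow> ('k, 'h) formal_sum \<Rightarrow> ('k, 'h) formal_sum" (infixl "\<star>" 70)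
  where "u \<star> v = lin (\<lambda>xs. lin (\<lambda>ys. formal (map2 (*) xs ys)) v) u"

lemma formal_mult_simps [simp]:
  "0 \<star> w = 0" "w \<star> 0 = 0"
  "(u + v) \<star> w = u \<star> w + v \<star> w" "w \<star> (u + v) = w \<star> u + w \<star> v"
  "(u - v) \<star> w = u \<star> w - v \<star> w" "w \<star> (u - v) = w \<star> u - w \<star> v"
  "formal_scale c u \<star> w = formal_scale c (u \<star> w)" "w \<star> formal_scale c u = formal_scale c (w \<star> u)"
  "formal xs \<star> formal ys = formal (map2 (*) xs ys)"
  by (simp_all add: formal_mult_def formal.lin_ext_fun_add formal.lin_ext_fun_diff formal.lin_ext_fun_scale)

lemma formal_mult_in_degree:
  "\<lbrakk>u \<in> formal_degree n; v \<in> formal_degree n\<rbrakk> \<Longrightarrow> u \<star> v \<in> formal_degree n"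
  unfolding formal_mult_def by (intro lin_in_degree) auto

text \<open>
  By trilinearity it suffices to compare single tuples; the three inductions remove the arguments one
  at a time.
\<close>

lemma formal_mult_assoc:
  fixes u v w :: "('k::field, 'h::ring_1) formal_sum"
  assumes "u \<in> formal_degree n" "v \<in> formal_degree n" "w \<in> formal_degree n"
  shows "u \<star> v \<star> w = u \<star> (v \<star> w)"
proof -
  have map2_assoc: "map2 (*) (map2 (*) xs ys) zs = map2 (*) xs (map2 (*) ys zs)" for xs ys zs :: "'h list"
    by (rule nth_equalityI) (auto simp: mult.assoc)
  have pure: "(formal xs \<star> formal ys) \<star> w = formal xs \<star> (formal ys \<star> w)" for xs ys :: "'h list"
    using assms(3) by (induction rule: formal_degree_induct) (simp_all add: map2_assoc)
  have half_pure: "formal xs \<star> v \<star> w = formal xs \<star> (v \<star> w)" for xs :: "'h list"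
    using assms(2)
    by (induction rule: formal_degree_induct) (simp_all add: pure del: formal_mult_simps(9))
  show ?thesis
    using assms(1) by (induction rule: formal_degree_induct) (simp_all add: half_pure)
qed

lemma formal_mult_one:
  fixes u :: "('k::field, 'h::ring_1) formal_sum"
  assumes "u \<in> formal_degree n"
  shows "formal (replicate n 1) \<star> u = u" "u \<star> formal (replicate n 1) = u"
proof -
  have pure: "map2 (*) (replicate n 1) xs = xs" "map2 (*) xs (replicate n 1) = xs"
    if "length xs = n" for xs :: "'h list"
    using that by (auto intro!: nth_equalityI)
  show "formal (replicate n 1) \<star> u = u"
    using assms by (induction rule: formal_degree_induct) (simp_all add: pure)
  show "u \<star> formal (replicate n 1) = u"
    using assms by (induction rule: formal_degree_induct) (simp_all add: pure)
qed

text \<open>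
  A bilinear identity, hence a consequence of the identity assumed on tuples.  Three different maps
  \<open>g\<close>, \<open>g1\<close>, \<open>g2\<close> are allowed because inserting into the tuples \<open>xs\<close>, \<open>ys\<close> and \<open>xs \<cdot> ys\<close> are three
  different maps.
\<close>

lemma lin_formal_mult:
  assumes "u \<in> formal_degree n" "v \<in> formal_degree n"
    and "\<And>xs ys. \<lbrakk>length xs = n; length ys = n\<rbrakk> \<Longrightarrow> g (map2 (*) xs ys) = map2 (*) (g1 xs) (g2 ys)"
  shows "lin (\<lambda>xs. formal (g xs)) (u \<star> v) = lin (\<lambda>xs. formal (g1 xs)) u \<star> lin (\<lambda>xs. formal (g2 xs)) v"
proof -
  have half_pure: "lin (\<lambda>xs. formal (g xs)) (formal xs \<star> v) = formal (g1 xs) \<star> lin (\<lambda>xs. formal (g2 xs)) v"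
    if "length xs = n" for xs
    using assms(2) by (induction rule: formal_degree_induct) (simp_all add: assms(3) that)
  show ?thesis
    using assms(1) by (induction rule: formal_degree_induct) (simp_all add: half_pure)
qed

section \<open>The tensor powers as monoids\<close>

context unital_algebra
begin

abbreviation relations :: "nat \<Rightarrow> ('k, 'h) formal_sum set"
  where "relations n \<equiv> formal.span (multilinear_relations scale n)"

lemma relations_subset_degree: "relations n \<subseteq> formal_degree n"
proof (rule formal.span_minimal[OF _ formal_degree_subspace])
  show "multilinear_relations scale n \<subseteq> formal_degree n"
    unfolding multilinear_relations_def
    by (auto intro!: formal_degree_closed)
qed

lemma lin_in_relations:
  assumes "u \<in> relations n"
    and "\<And>xs i a b. \<lbrakk>length xs = n; i < n\<rbrakk> \<Longrightarrow>
      f (xs[i := a + b]) - f (xs[i := a]) - f (xs[i := b]) \<in> relations m"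
    and "\<And>xs i c a. \<lbrakk>length xs = n; i < n\<rbrakk> \<Longrightarrow>
      f (xs[i := scale c a]) - formal_scale c (f (xs[i := a])) \<in> relations m"
  shows "lin f u \<in> relations m"
  using assms(1)
proof (induction rule: formal.span_induct_alt)
  case (step c x y)
  then have "lin f x \<in> relations m"
    using assms(2,3) unfolding multilinear_relations_def by auto
  with step show ?case by (auto intro: formal.span_add formal.span_scale)
qed (simp add: formal.span_zero)

lemma slot_relations:
  assumes "length ys = m" "k < m"
  shows "formal (ys[k := a + b]) - formal (ys[k := a]) - formal (ys[k := b]) \<in> relations m"
    and "formal (ys[k := scale c a]) - formal_scale c (formal (ys[k := a])) \<in> relations m"
  unfolding multilinear_relations_def using assms by (blast intro: formal.span_base)+

text \<open>
  The practical form of multilinearity for a map \<open>g\<close> between tuples: changing one entry of the argument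
  changes, linearly, one entry of the value.
\<close>

lemma lin_formal_in_relations:
  assumes "u \<in> relations n"
    and "\<And>xs i. \<lbrakk>length xs = n; i < n\<rbrakk> \<Longrightarrow> \<exists>ys k f. length ys = m \<and> k < m \<and>
      Vector_Spaces.linear scale scale f \<and> (\<forall>a. g (xs[i := a]) = ys[k := f a])"
  shows "lin (\<lambda>xs. formal (g xs)) u \<in> relations m"
proof (rule lin_in_relations[OF assms(1)])
  fix xs :: "'h list" and i a b c
  assume "length xs = n" "i < n"
  then obtain ys k f where "length ys = m" "k < m" and f: "Vector_Spaces.linear scale scale f"
    and "\<And>a. g (xs[i := a]) = ys[k := f a]"
    using assms(2) by blast
  then show "formal (g (xs[i := a + b])) - formal (g (xs[i := a])) - formal (g (xs[i := b])) \<in> relations m"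
    "formal (g (xs[i := scale c a])) - formal_scale c (formal (g (xs[i := a]))) \<in> relations m"
    using module_hom.add[OF f[unfolded linear_iff_module_hom]]
      module_hom.scale[OF f[unfolded linear_iff_module_hom]]
    by (simp_all add: slot_relations)
qed

lemma linear_mult_left: "Vector_Spaces.linear scale scale (\<lambda>a. b * a)"
  by unfold_locales (simp_all add: distrib_left flip: scale_mult_right)

lemma linear_mult_right: "Vector_Spaces.linear scale scale (\<lambda>a. a * b)"
  by unfold_locales (simp_all add: distrib_right flip: scale_mult_left)

lemma linear_identity: "Vector_Spaces.linear scale scale (\<lambda>a. a)"
  by unfold_locales simp_all

text \<open>
  Together with its mirror image this says that the relations form a two-sided ideal, so that the
  product of formal sums passes to the quotient.
\<close>

lemma formal_mult_in_relations_left: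
  assumes "u \<in> relations n" "v \<in> formal_degree n"
  shows "u \<star> v \<in> relations n"
  using assms(2)
proof (induction rule: formal_degree_induct)
  case (step c ys v)
  have "lin (\<lambda>xs. formal (map2 (*) xs ys)) u \<in> relations n"
    using assms(1)
  proof (rule lin_formal_in_relations)
    fix xs :: "'h list" and i
    assume "length xs = n" "i < n"
    then have "length (map2 (*) xs ys) = n"
      "map2 (*) (xs[i := a]) ys = (map2 (*) xs ys)[i := a * ys ! i]" for a
      using step(1) by (auto intro!: nth_equalityI simp: nth_list_update)
    then show "\<exists>zs k f. length zs = n \<and> k < n \<and> Vector_Spaces.linear scale scale f \<and>
        (\<forall>a. map2 (*) (xs[i := a]) ys = zs[k := f a])"
      using \<open>i < n\<close> linear_mult_right by blast
  qed
  then have "u \<star> formal ys \<in> relations n" by (simp add: formal_mult_def)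
  with step show ?case by (auto intro: formal.span_add formal.span_scale)
qed (simp add: formal.span_zero)

lemma formal_mult_in_relations_right:
  assumes "u \<in> formal_degree n" "v \<in> relations n"
  shows "u \<star> v \<in> relations n"
  using assms(1)
proof (induction rule: formal_degree_induct)
  case (step c xs u)
  have "lin (\<lambda>ys. formal (map2 (*) xs ys)) v \<in> relations n"
    using assms(2)
  proof (rule lin_formal_in_relations)
    fix ys :: "'h list" and i
    assume "length ys = n" "i < n"
    then have "length (map2 (*) xs ys) = n"
      "map2 (*) xs (ys[i := a]) = (map2 (*) xs ys)[i := xs ! i * a]" for a
      using step(1) by (auto intro!: nth_equalityI simp: nth_list_update)
    then show "\<exists>zs k f. length zs = n \<and> k < n \<and> Vector_Spaces.linear scale scale f \<and>
        (\<forall>a. map2 (*) xs (ys[i := a]) = zs[k := f a])"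
      using \<open>i < n\<close> linear_mult_left by blast
  qed
  then have "formal xs \<star> v \<in> relations n" by (simp add: formal_mult_def)
  with step show ?case by (auto intro: formal.span_add formal.span_scale)
qed (simp add: formal.span_zero)

lemma tensor_class_eq_iff: "tensor_class scale n u = tensor_class scale n v \<longleftrightarrow> u - v \<in> relations n"
proof
  assume "tensor_class scale n u = tensor_class scale n v"
  moreover have "u \<in> tensor_class scale n u"
    by (simp add: tensor_class_def formal.span_zero)
  ultimately show "u - v \<in> relations n"
    by (simp add: tensor_class_def)
next
  assume uv: "u - v \<in> relations n"
  then have "w - u \<in> relations n \<longleftrightarrow> w - v \<in> relations n" for w
    using formal.span_add[OF _ uv, of "w - u"] formal.span_diff[OF _ uv, of "w - v"] by auto
  then show "tensor_class scale n u = tensor_class scale n v"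
    by (simp add: tensor_class_def)
qed

lemma tensor_rep_class: "tensor_rep (tensor_class scale n u) - u \<in> relations n"
proof -
  have "u \<in> tensor_class scale n u"
    by (simp add: tensor_class_def formal.span_zero)
  then have "tensor_rep (tensor_class scale n u) \<in> tensor_class scale n u"
    unfolding tensor_rep_def by (rule someI)
  then show ?thesis by (simp add: tensor_class_def)
qed

lemma tensor_carrier_cases:
  assumes "A \<in> carrier (tensor_power scale n)"
  obtains u where "u \<in> formal_degree n" "A = tensor_class scale n u"
  using assms by (auto simp: tensor_power_def formal_degree_def)

lemma tensor_class_in_carrier: "u \<in> formal_degree n \<Longrightarrow> tensor_class scale n u \<in> carrier (tensor_power scale n)"
  by (auto simp: tensor_power_def formal_degree_def)

lemma tensor_rep_in_degree:
  assumes "A \<in> carrier (tensor_power scale n)"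
  shows "tensor_rep A \<in> formal_degree n"
proof -
  obtain u where u: "u \<in> formal_degree n" "A = tensor_class scale n u"
    using assms by (rule tensor_carrier_cases)
  then have "tensor_rep A - u \<in> formal_degree n"
    using relations_subset_degree tensor_rep_class by blast
  with u(1) show ?thesis
    using formal_degree_closed(2) by fastforce
qed

lemma tensor_class_rep:
  assumes "A \<in> carrier (tensor_power scale n)"
  shows "tensor_class scale n (tensor_rep A) = A"
  using assms by (elim tensor_carrier_cases) (simp add: tensor_class_eq_iff tensor_rep_class)

lemma tensor_class_mult:
  assumes "u \<in> formal_degree n" "v \<in> formal_degree n"
  shows "tensor_class scale n u \<otimes>\<^bsub>tensor_power scale n\<^esub> tensor_class scale n v = tensor_class scale n (u \<star> v)"
proof -
  let ?u = "tensor_rep (tensor_class scale n u)" and ?v = "tensor_rep (tensor_class scale n v)"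
  have "?u \<star> ?v - u \<star> v = (?u - u) \<star> ?v + u \<star> (?v - v)"
    by simp
  moreover have "(?u - u) \<star> ?v \<in> relations n"
    using assms(2) by (intro formal_mult_in_relations_left tensor_rep_class tensor_rep_in_degree
        tensor_class_in_carrier)
  moreover have "u \<star> (?v - v) \<in> relations n"
    using assms(1) by (intro formal_mult_in_relations_right tensor_rep_class)
  ultimately have "?u \<star> ?v - u \<star> v \<in> relations n"
    using formal.span_add by metis
  then show ?thesis
    by (simp add: tensor_power_def tensor_class_eq_iff flip: formal_mult_def)
qed

lemma tensor_class_one: "\<one>\<^bsub>tensor_power scale n\<^esub> = tensor_class scale n (formal (replicate n 1))"
  by (simp add: tensor_power_def)

lemma tensor_class_add:
  "tensor_class scale n u \<oplus>\<^bsub>tensor_power scale n\<^esub> tensor_class scale n v = tensor_class scale n (u + v)"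
  using formal.span_add[OF tensor_rep_class[of n u] tensor_rep_class[of n v]]
  by (simp add: tensor_power_def tensor_class_eq_iff algebra_simps)

lemma tensor_class_smult:
  "c \<odot>\<^bsub>tensor_power scale n\<^esub> tensor_class scale n u = tensor_class scale n (formal_scale c u)"
  using formal.span_scale[OF tensor_rep_class[of n u], of c]
  by (simp add: tensor_power_def tensor_class_eq_iff formal.scale_right_diff_distrib)

lemma tensor_power_monoid: "Group.monoid (tensor_power scale n)"
proof
  fix A B C
  assume "A \<in> carrier (tensor_power scale n)"
  then obtain u where u: "u \<in> formal_degree n" "A = tensor_class scale n u"
    by (rule tensor_carrier_cases)
  then show "\<one>\<^bsub>tensor_power scale n\<^esub> \<otimes>\<^bsub>tensor_power scale n\<^esub> A = A"
    "A \<otimes>\<^bsub>tensor_power scale n\<^esub> \<one>\<^bsub>tensor_power scale n\<^esub> = A"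
    by (simp_all add: tensor_class_one tensor_class_mult formal_mult_one)
  assume "B \<in> carrier (tensor_power scale n)"
  then obtain v where v: "v \<in> formal_degree n" "B = tensor_class scale n v"
    by (rule tensor_carrier_cases)
  with u show "A \<otimes>\<^bsub>tensor_power scale n\<^esub> B \<in> carrier (tensor_power scale n)"
    by (simp add: tensor_class_mult tensor_class_in_carrier formal_mult_in_degree)
  assume "C \<in> carrier (tensor_power scale n)"
  then obtain w where "w \<in> formal_degree n" "C = tensor_class scale n w"
    by (rule tensor_carrier_cases)
  with u v show "A \<otimes>\<^bsub>tensor_power scale n\<^esub> B \<otimes>\<^bsub>tensor_power scale n\<^esub> C =
      A \<otimes>\<^bsub>tensor_power scale n\<^esub> (B \<otimes>\<^bsub>tensor_power scale n\<^esub> C)"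
    by (simp add: tensor_class_mult formal_mult_in_degree formal_mult_assoc)
next
  show "\<one>\<^bsub>tensor_power scale n\<^esub> \<in> carrier (tensor_power scale n)"
    by (simp add: tensor_class_one tensor_class_in_carrier)
qed

end

section \<open>Relabelling tensor factors\<close>

text \<open>
  The maps of tuples that move the entries to new positions and fill the other positions with \<open>1\<close>.  The
  conditions make the induced map of tensor powers well defined, multiplicative and unital.
\<close>

definition placement :: "nat \<Rightarrow> nat \<Rightarrow> ('h::ring_1 list \<Rightarrow> 'h list) \<Rightarrow> bool"
  where "placement n m g \<longleftrightarrow>
    (\<forall>xs. length xs = n \<longrightarrow> length (g xs) = m) \<and>
    (\<forall>i<n. \<exists>k<m. \<forall>xs a. length xs = n \<longrightarrow> g (xs[i := a]) = (g xs)[k := a]) \<and>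
    (\<forall>xs ys. length xs = n \<longrightarrow> length ys = n \<longrightarrow> g (map2 (*) xs ys) = map2 (*) (g xs) (g ys)) \<and>
    g (replicate n 1) = replicate m 1"

lemma placement_perm:
  assumes "length p = n" "distinct p" "set p = {1..n}"
  shows "placement n n (\<lambda>xs. map (\<lambda>i. xs ! (i - 1)) p)"
  unfolding placement_def
proof (intro conjI allI impI)
  have entries: "1 \<le> p ! k \<and> p ! k \<le> n" if "k < n" for k
    using that assms(1,3) nth_mem[of k p] by auto
  have below: "p ! k - Suc 0 < n" if "k < n" for k
    using entries[OF that] by linarith
  fix i assume "i < n"
  then obtain k where k: "k < n" "p ! k = Suc i"
    using assms(1,3) by (metis Suc_le_eq atLeastAtMost_iff in_set_conv_nth le_add1 plus_1_eq_Suc)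
  have slot: "i = p ! k' - Suc 0 \<longleftrightarrow> k' = k" if "k' < n" for k'
    using k assms(1,2) entries[OF that] that nth_eq_iff_index_eq[of p k' k] by auto
  then have "\<forall>xs a. length xs = n \<longrightarrow>
      map (\<lambda>j. xs[i := a] ! (j - 1)) p = (map (\<lambda>j. xs ! (j - 1)) p)[k := a]"
    using assms(1) below \<open>i < n\<close> by (auto intro!: nth_equalityI simp: nth_list_update slot)
  then show "\<exists>k<n. \<forall>xs a. length xs = n \<longrightarrow>
      map (\<lambda>j. xs[i := a] ! (j - 1)) p = (map (\<lambda>j. xs ! (j - 1)) p)[k := a]"
    using k(1) by blast
next
  have below: "p ! k - Suc 0 < n" if "k < n" for k
    using that assms(1,3) nth_mem[of k p] by auto
  fix xs ys :: "'a list"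
  assume "length xs = n" "length ys = n"
  then show "map (\<lambda>i. map2 (*) xs ys ! (i - 1)) p =
      map2 (*) (map (\<lambda>i. xs ! (i - 1)) p) (map (\<lambda>i. ys ! (i - 1)) p)"
    using below assms(1) by (auto intro!: nth_equalityI)
next
  have below: "p ! k - Suc 0 < n" if "k < n" for k
    using that assms(1,3) nth_mem[of k p] by auto
  show "map (\<lambda>i. replicate n 1 ! (i - 1)) p = replicate n 1"
    using below assms(1) by (auto intro!: nth_equalityI)
qed (simp add: assms(1))

text \<open>
  Replaces the \<open>i\<close>-th entry of \<open>xs\<close>, counted from 1, by the tuple \<open>ds\<close>.  Applying \<open>\<Delta>\<close> to the \<open>i\<close>-th
  factor is insertion of a representative of the coproduct; with \<open>xs\<close> consisting of ones it also gives
  the embeddings of \<open>H \<otimes> H\<close> as two neighbouring factors.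
\<close>

definition insert_at :: "nat \<Rightarrow> 'h list \<Rightarrow> 'h list \<Rightarrow> 'h list"
  where "insert_at i xs ds = take (i - 1) xs @ ds @ drop i xs"

lemma map2_insert_at:
  assumes "length xs = length ys" "length ds = length es"
  shows "map2 f (insert_at i xs ds) (insert_at i ys es) = insert_at i (map2 f xs ys) (map2 f ds es)"
  using assms by (simp add: insert_at_def take_zip drop_zip take_map drop_map)

lemma insert_at_update_inserted:
  assumes "1 \<le> i" "i \<le> length xs" "j < length ds"
  shows "insert_at i xs (ds[j := a]) = (insert_at i xs ds)[i - 1 + j := a]"
  using assms by (auto intro!: nth_equalityI simp: insert_at_def nth_append nth_list_update min_def)

text \<open>
  Inserting a pair moves the entries behind position \<open>i\<close> by one place.
\<close>

lemma insert_at_update_outside: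
  assumes "1 \<le> i" "i \<le> length xs" "length ds = 2" "j < length xs" "j \<noteq> i - 1"
  shows "insert_at i (xs[j := a]) ds = (insert_at i xs ds)[(if j < i - 1 then j else Suc j) := a]"
  using assms by (auto intro!: nth_equalityI simp: insert_at_def nth_append nth_list_update min_def)

lemma insert_at_ones:
  assumes "1 \<le> i" "i \<le> n"
  shows "insert_at i (replicate n 1) (replicate 2 1) = replicate (Suc n) (1 :: 'h::ring_1)"
  using assms by (auto intro!: nth_equalityI simp: insert_at_def nth_append min_def simp del: replicate.simps)

lemma length_insert_at:
  "\<lbrakk>1 \<le> i; i \<le> length xs; length ds = 2\<rbrakk> \<Longrightarrow> length (insert_at i xs ds) = Suc (length xs)"
  by (simp add: insert_at_def)

lemma placement_insert_ones:
  assumes "1 \<le> i" "i \<le> n"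
  shows "placement 2 (Suc n) (insert_at i (replicate n (1 :: 'h::ring_1)))"
  unfolding placement_def
proof (intro conjI allI impI)
  fix j :: nat assume "j < 2"
  then show "\<exists>k<Suc n. \<forall>xs a. length xs = 2 \<longrightarrow>
      insert_at i (replicate n (1 :: 'h)) (xs[j := a]) = (insert_at i (replicate n 1) xs)[k := a]"
    using assms by (intro exI[of _ "i - 1 + j"]) (simp add: insert_at_update_inserted)
next
  fix xs ys :: "'h list"
  assume "length xs = 2" "length ys = 2"
  moreover have "map2 (*) (replicate n 1) (replicate n 1) = replicate n (1 :: 'h)"
    by (auto intro!: nth_equalityI)
  ultimately show "insert_at i (replicate n 1) (map2 (*) xs ys) =
      map2 (*) (insert_at i (replicate n 1) xs) (insert_at i (replicate n 1) ys)"
    by (subst map2_insert_at) simp_all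
next
  show "insert_at i (replicate n 1) (replicate 2 1) = replicate (Suc n) (1 :: 'h)"
    using assms by (rule insert_at_ones)
qed (use assms in \<open>simp add: length_insert_at\<close>)

context unital_algebra
begin

lemma relations_cong_step:
  assumes "a - b \<in> relations n" "u - v \<in> relations n"
  shows "(formal_scale c a + u) - (formal_scale c b + v) \<in> relations n"
proof -
  have "(formal_scale c a + u) - (formal_scale c b + v) = formal_scale c (a - b) + (u - v)"
    by (simp add: formal.scale_right_diff_distrib)
  then show ?thesis using assms by (simp only: formal.span_add formal.span_scale)
qed

lemma lin_placement_in_relations:
  assumes "placement n m g" "u \<in> relations n"
  shows "lin (\<lambda>xs. formal (g xs)) u \<in> relations m"
  using assms(2)
proof (rule lin_formal_in_relations)
  fix xs :: "'h list" and i
  assume "length xs = n" "i < n"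
  then show "\<exists>ys k f. length ys = m \<and> k < m \<and> Vector_Spaces.linear scale scale f \<and>
      (\<forall>a. g (xs[i := a]) = ys[k := f a])"
    using assms(1) linear_identity unfolding placement_def by metis
qed

lemma tensor_map_class:
  assumes "placement n m g"
  shows "tensor_map scale m g (tensor_class scale n u) = tensor_class scale m (lin (\<lambda>xs. formal (g xs)) u)"
  unfolding tensor_map_def tensor_class_eq_iff
  using lin_placement_in_relations[OF assms tensor_rep_class[of n u]] by simp

lemma lin_placement_in_degree:
  "\<lbrakk>placement n m g; u \<in> formal_degree n\<rbrakk> \<Longrightarrow> lin (\<lambda>xs. formal (g xs)) u \<in> formal_degree m"
  by (rule lin_in_degree) (auto simp: placement_def)

lemma tensor_map_hom:
  assumes g: "placement n m g"
  shows "tensor_map scale m g \<in> hom (tensor_power scale n) (tensor_power scale m)"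
proof (rule homI)
  fix A B
  assume "A \<in> carrier (tensor_power scale n)"
  then obtain u where u: "u \<in> formal_degree n" "A = tensor_class scale n u"
    by (rule tensor_carrier_cases)
  then show "tensor_map scale m g A \<in> carrier (tensor_power scale m)"
    by (simp add: tensor_map_class[OF g] tensor_class_in_carrier lin_placement_in_degree[OF g])
  assume "B \<in> carrier (tensor_power scale n)"
  then obtain v where v: "v \<in> formal_degree n" "B = tensor_class scale n v"
    by (rule tensor_carrier_cases)
  have "lin (\<lambda>xs. formal (g xs)) (u \<star> v) = lin (\<lambda>xs. formal (g xs)) u \<star> lin (\<lambda>xs. formal (g xs)) v"
    using u(1) v(1) by (rule lin_formal_mult) (use g in \<open>simp add: placement_def\<close>)
  with u v show "tensor_map scale m g (A \<otimes>\<^bsub>tensor_power scale n\<^esub> B) =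
      tensor_map scale m g A \<otimes>\<^bsub>tensor_power scale m\<^esub> tensor_map scale m g B"
    by (simp add: tensor_class_mult tensor_map_class[OF g] lin_placement_in_degree[OF g])
qed

lemma tensor_map_one:
  assumes "placement n m g"
  shows "tensor_map scale m g \<one>\<^bsub>tensor_power scale n\<^esub> = \<one>\<^bsub>tensor_power scale m\<^esub>"
  using assms by (simp add: tensor_class_one tensor_map_class placement_def)

lemma tensor_map_cong:
  assumes "A \<in> carrier (tensor_power scale n)" "\<And>xs. length xs = n \<Longrightarrow> f xs = g xs"
  shows "tensor_map scale m f A = tensor_map scale m g A"
proof -
  have "lin (\<lambda>xs. formal (f xs)) (tensor_rep A) = lin (\<lambda>xs. formal (g xs)) (tensor_rep A)"
    using tensor_rep_in_degree[OF assms(1)] by (rule lin_cong) (simp add: assms(2))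
  then show ?thesis by (simp add: tensor_map_def)
qed

lemma tensor_map_comp:
  assumes f: "placement n m f" and A: "A \<in> carrier (tensor_power scale n)"
    and g: "placement m l g" and eq: "\<And>xs. length xs = n \<Longrightarrow> g (f xs) = e xs"
  shows "tensor_map scale l g (tensor_map scale m f A) = tensor_map scale l e A"
proof -
  have "tensor_map scale l g (tensor_map scale m f A) = tensor_map scale l (\<lambda>xs. g (f xs)) A"
    unfolding tensor_map_def[of _ m f] tensor_map_class[OF g]
    by (simp add: tensor_map_def lin_lin)
  also have "\<dots> = tensor_map scale l e A"
    using A eq by (rule tensor_map_cong)
  finally show ?thesis .
qed

end

section \<open>Applying the coproduct to a tensor factor\<close>

definition insert_lin :: "nat \<Rightarrow> 'h list \<Rightarrow> ('k::field, 'h) formal_sum \<Rightarrow> ('k, 'h) formal_sum"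
  where "insert_lin i xs = lin (\<lambda>ds. formal (insert_at i xs ds))"

lemma insert_lin_simps [simp]:
  "insert_lin i xs 0 = 0" "insert_lin i xs (u + v) = insert_lin i xs u + insert_lin i xs v"
  "insert_lin i xs (u - v) = insert_lin i xs u - insert_lin i xs v"
  "insert_lin i xs (formal_scale c u) = formal_scale c (insert_lin i xs u)"
  "insert_lin i xs (formal ds) = formal (insert_at i xs ds)"
  by (simp_all add: insert_lin_def)

lemma insert_lin_in_degree:
  "\<lbrakk>1 \<le> i; i \<le> n; length xs = n; t \<in> formal_degree 2\<rbrakk> \<Longrightarrow> insert_lin i xs t \<in> formal_degree (Suc n)"
  unfolding insert_lin_def by (erule lin_in_degree) (simp add: length_insert_at)

lemma insert_lin_mult:
  assumes "length xs = length ys" "s \<in> formal_degree 2" "t \<in> formal_degree 2"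
  shows "insert_lin i xs s \<star> insert_lin i ys t = insert_lin i (map2 (*) xs ys) (s \<star> t)"
  unfolding insert_lin_def
  by (rule lin_formal_mult[symmetric, OF assms(2,3)]) (simp only: map2_insert_at assms(1))

context quasi_bialgebra
begin

lemma insert_lin_in_relations:
  assumes "1 \<le> i" "i \<le> n" "length xs = n" "t \<in> relations 2"
  shows "insert_lin i xs t \<in> relations (Suc n)"
  unfolding insert_lin_def using assms(4)
proof (rule lin_formal_in_relations)
  fix ds :: "'h list" and j :: nat
  assume "length ds = 2" "j < 2"
  then have "length (insert_at i xs ds) = Suc n" "i - 1 + j < Suc n"
    "insert_at i xs (ds[j := a]) = (insert_at i xs ds)[i - 1 + j := a]" for a
    using assms insert_at_update_inserted[of i xs j ds] length_insert_at[of i xs ds] by auto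
  then show "\<exists>ys k f. length ys = Suc n \<and> k < Suc n \<and> Vector_Spaces.linear scale scale f \<and>
      (\<forall>a. insert_at i xs (ds[j := a]) = ys[k := f a])"
    using linear_identity by blast
qed

text \<open>
  For a fixed inserted pair this is one of the defining relations; the general case follows by linearity
  in \<open>t\<close>.
\<close>

lemma insert_lin_outer_relations:
  assumes i: "1 \<le> i" "i \<le> n" and xs: "length xs = n" and t: "t \<in> formal_degree 2"
    and j: "j < n" "j \<noteq> i - 1"
  shows "insert_lin i (xs[j := a + b]) t - insert_lin i (xs[j := a]) t - insert_lin i (xs[j := b]) t
      \<in> relations (Suc n)"
    and "insert_lin i (xs[j := scale c a]) t - formal_scale c (insert_lin i (xs[j := a]) t)
      \<in> relations (Suc n)"
proof -
  define k where "k = (if j < i - 1 then j else Suc j)"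
  have k: "k < Suc n" using j by (simp add: k_def)
  have update: "insert_at i (xs[j := x]) ds = (insert_at i xs ds)[k := x]" if "length ds = 2" for x ds
    unfolding k_def using i xs j that by (intro insert_at_update_outside) simp_all
  have len: "length (insert_at i xs ds) = Suc n" if "length ds = 2" for ds
    using i xs that length_insert_at[of i xs ds] by simp
  let ?D = "\<lambda>t. lin (\<lambda>ds. formal ((insert_at i xs ds)[k := a + b]) - formal ((insert_at i xs ds)[k := a])
      - formal ((insert_at i xs ds)[k := b])) t"
  let ?E = "\<lambda>t. lin (\<lambda>ds. formal ((insert_at i xs ds)[k := scale c a])
      - formal_scale c (formal ((insert_at i xs ds)[k := a]))) t"
  have "?D t \<in> relations (Suc n)"
    using t by (induction rule: formal_degree_induct)
      (simp_all add: formal.span_zero formal.span_add formal.span_scale slot_relations len k)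
  moreover have "?D t = insert_lin i (xs[j := a + b]) t - insert_lin i (xs[j := a]) t
      - insert_lin i (xs[j := b]) t"
    unfolding insert_lin_def formal.lin_ext_fun_diff[symmetric] using t
    by (rule lin_cong) (simp only: update)
  ultimately show "insert_lin i (xs[j := a + b]) t - insert_lin i (xs[j := a]) t
      - insert_lin i (xs[j := b]) t \<in> relations (Suc n)"
    by simp
  have "?E t \<in> relations (Suc n)"
    using t by (induction rule: formal_degree_induct)
      (simp_all add: formal.span_zero formal.span_add formal.span_scale slot_relations len k)
  moreover have "?E t = insert_lin i (xs[j := scale c a]) t - formal_scale c (insert_lin i (xs[j := a]) t)"
    unfolding insert_lin_def formal.lin_ext_fun_scale[symmetric] formal.lin_ext_fun_diff[symmetric]
    using t by (rule lin_cong) (simp only: update)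
  ultimately show "insert_lin i (xs[j := scale c a]) t - formal_scale c (insert_lin i (xs[j := a]) t)
      \<in> relations (Suc n)"
    by simp
qed

abbreviation \<Delta>_rep :: "'h \<Rightarrow> ('k, 'h) formal_sum"
  where "\<Delta>_rep a \<equiv> tensor_rep (\<Delta> a)"

lemma \<Delta>_rep_in_degree: "\<Delta>_rep a \<in> formal_degree 2"
  by (rule tensor_rep_in_degree[OF comult_closed])

lemma \<Delta>_class: "\<Delta> a = tensor_class scale 2 (\<Delta>_rep a)"
  by (simp add: tensor_class_rep comult_closed)

text \<open>
  The chosen representatives of \<open>\<Delta> a\<close> depend on \<open>a\<close> linearly and multiplicatively only modulo the
  relations.
\<close>

lemma \<Delta>_rep_relations:
  "\<Delta>_rep (a + b) - (\<Delta>_rep a + \<Delta>_rep b) \<in> relations 2"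
  "\<Delta>_rep (scale c a) - formal_scale c (\<Delta>_rep a) \<in> relations 2"
  "\<Delta>_rep (a * b) - \<Delta>_rep a \<star> \<Delta>_rep b \<in> relations 2"
  "\<Delta>_rep 1 - formal (replicate 2 1) \<in> relations 2"
  unfolding tensor_class_eq_iff[symmetric] tensor_class_add[symmetric] tensor_class_smult[symmetric]
    tensor_class_mult[OF \<Delta>_rep_in_degree \<Delta>_rep_in_degree, symmetric] \<Delta>_class[symmetric]
    tensor_class_one[symmetric]
  by (rule comult_add comult_scale comult_mult comult_one)+

definition comult_at :: "nat \<Rightarrow> ('k, 'h) formal_sum \<Rightarrow> ('k, 'h) formal_sum"
  where "comult_at i = lin (\<lambda>xs. insert_lin i xs (\<Delta>_rep (xs ! (i - 1))))"

lemma comult_at_simps [simp]: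
  "comult_at i 0 = 0" "comult_at i (u + v) = comult_at i u + comult_at i v"
  "comult_at i (u - v) = comult_at i u - comult_at i v"
  "comult_at i (formal_scale c u) = formal_scale c (comult_at i u)"
  "comult_at i (formal xs) = insert_lin i xs (\<Delta>_rep (xs ! (i - 1)))"
  by (simp_all add: comult_at_def)

lemma comult_at_in_degree:
  "\<lbrakk>1 \<le> i; i \<le> n; u \<in> formal_degree n\<rbrakk> \<Longrightarrow> comult_at i u \<in> formal_degree (Suc n)"
  unfolding comult_at_def by (erule lin_in_degree) (simp add: insert_lin_in_degree \<Delta>_rep_in_degree)

text \<open>
  A relation in the factor to which \<open>\<Delta>\<close> is applied is respected because \<open>\<Delta>\<close> is linear, one in another
  factor because insertion is multilinear in the remaining entries.
\<close>

lemma comult_at_in_relations: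
  assumes i: "1 \<le> i" "i \<le> n" and u: "u \<in> relations n"
  shows "comult_at i u \<in> relations (Suc n)"
  unfolding comult_at_def using u
proof (rule lin_in_relations)
  fix xs :: "'h list" and j a b c
  assume xs: "length xs = n" and j: "j < n"
  let ?I = "\<lambda>xs. insert_lin i xs (\<Delta>_rep (xs ! (i - 1)))"
  have "?I (xs[j := a + b]) - ?I (xs[j := a]) - ?I (xs[j := b]) \<in> relations (Suc n) \<and>
      ?I (xs[j := scale c a]) - formal_scale c (?I (xs[j := a])) \<in> relations (Suc n)"
  proof (cases "j = i - 1")
    case True
    have same: "insert_at i (xs[j := x]) ds = insert_at i xs ds" for x ds
      using True i by (simp add: insert_at_def)
    have same_lin: "insert_lin i (xs[j := x]) = insert_lin i xs" for x
      unfolding insert_lin_def same ..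
    have "insert_lin i xs (\<Delta>_rep (a + b) - (\<Delta>_rep a + \<Delta>_rep b)) \<in> relations (Suc n)"
      "insert_lin i xs (\<Delta>_rep (scale c a) - formal_scale c (\<Delta>_rep a)) \<in> relations (Suc n)"
      using i xs by (intro insert_lin_in_relations \<Delta>_rep_relations; simp)+
    moreover have "xs[j := x] ! (i - 1) = x" for x
      using True xs j by simp
    ultimately show ?thesis
      by (simp add: same_lin diff_diff_eq del: One_nat_def)
  next
    case False
    then show ?thesis
      using insert_lin_outer_relations[OF i xs \<Delta>_rep_in_degree j False] by simp
  qed
  then show "?I (xs[j := a + b]) - ?I (xs[j := a]) - ?I (xs[j := b]) \<in> relations (Suc n)"
    "?I (xs[j := scale c a]) - formal_scale c (?I (xs[j := a])) \<in> relations (Suc n)"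
    by blast+
qed

lemma apply_at_class:
  assumes "1 \<le> i" "i \<le> n"
  shows "apply_at scale n i \<Delta> (tensor_class scale n u) = tensor_class scale (Suc n) (comult_at i u)"
  using comult_at_in_relations[OF assms tensor_rep_class[of n u]]
  by (simp add: apply_at_def tensor_class_eq_iff flip: insert_at_def insert_lin_def comult_at_def del: One_nat_def)

text \<open>
  On single tuples, multiplicativity of \<open>\<Delta>\<close> is inserted at the \<open>i\<close>-th place; bilinearity does the rest.
\<close>

lemma comult_at_mult:
  assumes i: "1 \<le> i" "i \<le> n" and u: "u \<in> formal_degree n" and v: "v \<in> formal_degree n"
  shows "comult_at i (u \<star> v) - comult_at i u \<star> comult_at i v \<in> relations (Suc n)"
proof -
  have pure: "comult_at i (formal xs \<star> formal ys) - comult_at i (formal xs) \<star> comult_at i (formal ys)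
      \<in> relations (Suc n)" if "length xs = n" "length ys = n" for xs ys
  proof -
    let ?x = "xs ! (i - 1)" and ?y = "ys ! (i - 1)"
    have "insert_lin i (map2 (*) xs ys) (\<Delta>_rep (?x * ?y) - \<Delta>_rep ?x \<star> \<Delta>_rep ?y) \<in> relations (Suc n)"
      using i that by (intro insert_lin_in_relations \<Delta>_rep_relations) simp_all
    then show ?thesis
      using i that by (simp add: insert_lin_mult \<Delta>_rep_in_degree)
  qed
  have half_pure: "comult_at i (formal xs \<star> v) - comult_at i (formal xs) \<star> comult_at i v \<in> relations (Suc n)"
    if "length xs = n" for xs
    using v
  proof (induction rule: formal_degree_induct)
    case (step c ys v)
    then show ?case
      using relations_cong_step[OF pure[OF that step(1)] step(3), of c]
      by (simp del: formal_mult_simps(9) comult_at_simps(5))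
  qed (simp add: formal.span_zero)
  show ?thesis
    using u
  proof (induction rule: formal_degree_induct)
    case (step c xs u)
    then show ?case
      using relations_cong_step[OF half_pure[OF step(1)] step(3), of c]
      by (simp del: comult_at_simps(5))
  qed (simp add: formal.span_zero)
qed

lemma apply_at_hom:
  assumes i: "1 \<le> i" "i \<le> n"
  shows "apply_at scale n i \<Delta> \<in> hom (tensor_power scale n) (tensor_power scale (Suc n))"
proof (rule homI)
  fix A B
  assume "A \<in> carrier (tensor_power scale n)"
  then obtain u where u: "u \<in> formal_degree n" "A = tensor_class scale n u"
    by (rule tensor_carrier_cases)
  then show "apply_at scale n i \<Delta> A \<in> carrier (tensor_power scale (Suc n))"
    by (simp add: apply_at_class[OF i] tensor_class_in_carrier comult_at_in_degree[OF i])
  assume "B \<in> carrier (tensor_power scale n)"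
  then obtain v where v: "v \<in> formal_degree n" "B = tensor_class scale n v"
    by (rule tensor_carrier_cases)
  with u show "apply_at scale n i \<Delta> (A \<otimes>\<^bsub>tensor_power scale n\<^esub> B) =
      apply_at scale n i \<Delta> A \<otimes>\<^bsub>tensor_power scale (Suc n)\<^esub> apply_at scale n i \<Delta> B"
    by (simp add: tensor_class_mult apply_at_class[OF i] comult_at_in_degree[OF i] tensor_class_eq_iff
        comult_at_mult[OF i])
qed

lemma apply_at_one:
  assumes i: "1 \<le> i" "i \<le> n"
  shows "apply_at scale n i \<Delta> \<one>\<^bsub>tensor_power scale n\<^esub> = \<one>\<^bsub>tensor_power scale (Suc n)\<^esub>"
proof -
  have "insert_lin i (replicate n 1) (\<Delta>_rep 1 - formal (replicate 2 1)) \<in> relations (Suc n)"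
    using i by (intro insert_lin_in_relations \<Delta>_rep_relations) simp_all
  then have "comult_at i (formal (replicate n 1)) - formal (replicate (Suc n) 1) \<in> relations (Suc n)"
    using i unfolding insert_at_ones[OF i, symmetric] by (simp del: replicate.simps)
  then show ?thesis
    by (simp add: tensor_class_one apply_at_class[OF i] tensor_class_eq_iff)
qed

end

context quasi_triangular_quasi_hopf_algebra
begin

text \<open>
  The relation \<open>\<Delta>\<^sup>T(a) \<R> = \<R> \<Delta>(a)\<close> inserted at the \<open>i\<close>-th factor: \<open>\<R>\<close>, placed at the two factors
  produced by \<open>\<Delta>\<close>, exchanges them.  The exchange is kept as an arbitrary relabelling \<open>g\<close> acting
  correctly on tuples with an inserted pair.
\<close>

lemma R_comult_at:
  assumes i: "1 \<le> i" "i \<le> n" and g: "placement (Suc n) (Suc n) g"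
    and g_swap: "\<And>xs d e. length xs = n \<Longrightarrow> g (insert_at i xs [d, e]) = insert_at i xs [e, d]"
    and A: "A \<in> carrier (tensor_power scale n)"
  shows "tensor_map scale (Suc n) (insert_at i (replicate n 1)) \<R> \<otimes>\<^bsub>tensor_power scale (Suc n)\<^esub>
      apply_at scale n i \<Delta> A =
    tensor_map scale (Suc n) g (apply_at scale n i \<Delta> A) \<otimes>\<^bsub>tensor_power scale (Suc n)\<^esub>
      tensor_map scale (Suc n) (insert_at i (replicate n 1)) \<R>"
proof -
  have "\<R> \<in> carrier (tensor_power scale 2)"
    using R_invertible by (simp add: Units_def)
  then obtain r where r: "r \<in> formal_degree 2" "\<R> = tensor_class scale 2 r"
    by (rule tensor_carrier_cases)
  let ?flip = "lin (\<lambda>xs. formal (map (\<lambda>i. xs ! (i - 1)) [2, 1]))"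
  let ?r = "insert_lin i (replicate n 1) r"
  let ?g = "lin (\<lambda>xs. formal (g xs))"
  have flip_degree: "?flip t \<in> formal_degree 2" if "t \<in> formal_degree 2" for t :: "('k, 'h) formal_sum"
    using that by (rule lin_in_degree) simp
  have flip_comm: "r \<star> \<Delta>_rep a - ?flip (\<Delta>_rep a) \<star> r \<in> relations 2" for a
  proof -
    have "perm scale [2, 1] (\<Delta> a) = tensor_class scale 2 (?flip (\<Delta>_rep a))"
      by (simp add: perm_def tensor_map_def numeral_2_eq_2)
    then have "tensor_class scale 2 (?flip (\<Delta>_rep a)) \<otimes>\<^bsub>tensor_power scale 2\<^esub> tensor_class scale 2 r =
        tensor_class scale 2 r \<otimes>\<^bsub>tensor_power scale 2\<^esub> tensor_class scale 2 (\<Delta>_rep a)"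
      using R_comult[of a] by (simp only: r(2) \<Delta>_class[symmetric])
    then show ?thesis
      unfolding tensor_class_mult[OF r(1) \<Delta>_rep_in_degree]
        tensor_class_mult[OF flip_degree[OF \<Delta>_rep_in_degree] r(1)]
      by (simp only: tensor_class_eq_iff[symmetric])
  qed
  have pure: "?r \<star> comult_at i (formal xs) - ?g (comult_at i (formal xs)) \<star> ?r \<in> relations (Suc n)"
    if xs: "length xs = n" for xs
  proof -
    let ?t = "\<Delta>_rep (xs ! (i - 1))"
    have ones: "map2 (*) (replicate n 1) xs = xs" "map2 (*) xs (replicate n 1) = xs"
      using xs by (auto intro!: nth_equalityI)
    have "?g (insert_lin i xs ?t) = lin (\<lambda>ds. formal (g (insert_at i xs ds))) ?t"
      by (simp add: insert_lin_def lin_lin)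
    also have "\<dots> = lin (\<lambda>ds. formal (insert_at i xs (map (\<lambda>i. ds ! (i - 1)) [2, 1]))) ?t"
      using \<Delta>_rep_in_degree
    proof (rule lin_cong)
      fix ds :: "'h list" assume "length ds = 2"
      then obtain d e where "ds = [d, e]" by (auto simp: numeral_2_eq_2 length_Suc_conv)
      then show "formal (g (insert_at i xs ds)) =
          formal (insert_at i xs (map (\<lambda>i. ds ! (i - 1)) [2, 1]))"
        by (simp only: g_swap[OF xs]) simp
    qed
    also have "\<dots> = insert_lin i xs (?flip ?t)"
      by (simp add: insert_lin_def lin_lin)
    finally have g_insert: "?g (insert_lin i xs ?t) = insert_lin i xs (?flip ?t)" .
    have "insert_lin i xs (r \<star> ?t - ?flip ?t \<star> r) \<in> relations (Suc n)"
      using i xs flip_comm by (rule insert_lin_in_relations)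
    then show ?thesis
      using xs r(1) flip_degree[OF \<Delta>_rep_in_degree]
      by (simp add: g_insert insert_lin_mult \<Delta>_rep_in_degree ones del: One_nat_def)
  qed
  have comm: "?r \<star> comult_at i u - ?g (comult_at i u) \<star> ?r \<in> relations (Suc n)"
    if "u \<in> formal_degree n" for u
    using that
  proof (induction rule: formal_degree_induct)
    case (step c xs u)
    then show ?case
      using relations_cong_step[OF pure[OF step(1)] step(3), of c]
      by (simp del: comult_at_simps(5))
  qed (simp add: formal.span_zero)
  obtain u where u: "u \<in> formal_degree n" "A = tensor_class scale n u"
    using A by (rule tensor_carrier_cases)
  have "?r \<in> formal_degree (Suc n)"
    using i r(1) by (simp add: insert_lin_in_degree)
  moreover have "tensor_map scale (Suc n) (insert_at i (replicate n 1)) \<R> = tensor_class scale (Suc n) ?r"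
    using r(2) tensor_map_class[OF placement_insert_ones[OF i]] by (simp add: insert_lin_def)
  ultimately show ?thesis
    using u comm[OF u(1)]
    by (simp add: apply_at_class[OF i] tensor_map_class[OF g] comult_at_in_degree[OF i]
      lin_placement_in_degree[OF g] tensor_class_mult tensor_class_eq_iff)
qed

end

section \<open>Gauge transformations in a monoid\<close>

context Group.monoid
begin

text \<open>
  Think of \<open>x\<close> as a map from an object with automorphism \<open>b\<close> to one with automorphism \<open>a\<close>; its gauge
  transform is \<open>a x b\<inverse>\<close>.  Composable gauge transforms telescope.
\<close>

lemma gauge_mult:
  assumes "u = a \<otimes> x \<otimes> inv b" "v = b \<otimes> y \<otimes> inv c"
    and "a \<in> carrier G" "x \<in> carrier G" "y \<in> carrier G" "b \<in> Units G" "c \<in> Units G"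
  shows "u \<otimes> v = a \<otimes> (x \<otimes> y) \<otimes> inv c"
proof -
  have "inv b \<otimes> (b \<otimes> z) = z" if "z \<in> carrier G" for z
    using that assms(6) by (simp add: Units_closed flip: m_assoc)
  then show ?thesis
    using assms by (simp add: m_assoc Units_closed)
qed

lemma inv_mult_Units:
  assumes "x \<in> Units G" "y \<in> Units G"
  shows "inv (x \<otimes> y) = inv y \<otimes> inv x"
proof -
  have "x \<otimes> y \<otimes> (inv y \<otimes> inv x) = x \<otimes> (y \<otimes> inv y) \<otimes> inv x"
    using assms by (simp only: m_assoc Units_closed Units_inv_closed m_closed)
  then have r: "x \<otimes> y \<otimes> (inv y \<otimes> inv x) = \<one>" using assms by (simp add: Units_closed)
  have "inv y \<otimes> inv x \<otimes> (x \<otimes> y) = inv y \<otimes> (inv x \<otimes> x) \<otimes> y"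
    using assms by (simp only: m_assoc Units_closed Units_inv_closed m_closed)
  then have l: "inv y \<otimes> inv x \<otimes> (x \<otimes> y) = \<one>" using assms by (simp add: Units_closed)
  show ?thesis
    by (rule inv_unique'[symmetric]) (use assms l r in \<open>auto intro: Units_closed\<close>)
qed

text \<open>
  An element \<open>r\<close> that intertwines \<open>a\<close> and \<open>a'\<close> is invariant under the gauge transformation by them, so
  they may be added to any other one.
\<close>

lemma gauge_absorb:
  assumes "r \<otimes> a = a' \<otimes> r"
    and "f' \<in> carrier G" "a' \<in> carrier G" "r \<in> carrier G" "f \<in> Units G" "a \<in> Units G"
  shows "f' \<otimes> r \<otimes> inv f = (f' \<otimes> a') \<otimes> r \<otimes> inv (f \<otimes> a)"
proof -
  have "(f' \<otimes> a') \<otimes> r \<otimes> inv (f \<otimes> a) = f' \<otimes> (a' \<otimes> r) \<otimes> inv a \<otimes> inv f"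
    using assms(2-6) by (simp add: inv_mult_Units m_assoc Units_closed)
  also have "\<dots> = f' \<otimes> r \<otimes> (a \<otimes> inv a) \<otimes> inv f"
    unfolding assms(1)[symmetric] using assms(2-6) by (simp add: m_assoc Units_closed del: Units_r_inv)
  finally show ?thesis
    using assms(2-6) by (simp add: Units_closed)
qed

lemma gauge_inv:
  assumes "y \<otimes> x = x \<otimes> z" "x \<in> Units G" "y \<in> Units G" "z \<in> Units G"
  shows "x = y \<otimes> x \<otimes> inv z" "inv x = z \<otimes> inv x \<otimes> inv y"
proof -
  show "x = y \<otimes> x \<otimes> inv z"
    using assms by (simp add: m_assoc Units_closed)
  have "z \<otimes> inv x = inv x \<otimes> (x \<otimes> z) \<otimes> inv x"
    using assms(2,4) by (simp add: Units_closed flip: m_assoc)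
  also have "\<dots> = inv x \<otimes> y"
    unfolding assms(1)[symmetric] using assms(2,3) by (simp add: m_assoc Units_closed)
  finally show "inv x = z \<otimes> inv x \<otimes> inv y"
    using assms by (simp add: m_assoc Units_closed)
qed

end

lemma hom_Units:
  assumes "Group.monoid G" "Group.monoid H" "f \<in> hom G H" "f \<one>\<^bsub>G\<^esub> = \<one>\<^bsub>H\<^esub>" "x \<in> Units G"
  shows "f x \<in> Units H" "f (inv\<^bsub>G\<^esub> x) = inv\<^bsub>H\<^esub> (f x)"
proof -
  interpret G: Group.monoid G by (rule assms)
  interpret H: Group.monoid H by (rule assms)
  have f: "f x \<in> carrier H" "f (inv\<^bsub>G\<^esub> x) \<in> carrier H"
    "f x \<otimes>\<^bsub>H\<^esub> f (inv\<^bsub>G\<^esub> x) = \<one>\<^bsub>H\<^esub>" "f (inv\<^bsub>G\<^esub> x) \<otimes>\<^bsub>H\<^esub> f x = \<one>\<^bsub>H\<^esub>"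
    using assms(3-5) hom_in_carrier[OF assms(3)] by (simp_all add: G.Units_closed flip: hom_mult)
  then show "f x \<in> Units H" by (auto simp: Units_def)
  with f show "f (inv\<^bsub>G\<^esub> x) = inv\<^bsub>H\<^esub> (f x)"
    by (metis H.inv_unique')
qed

section \<open>Permutations and legs in the threefold tensor power\<close>

context unital_algebra
begin

lemma tensor_map_Units:
  assumes "placement n m g" "A \<in> Units (tensor_power scale n)"
  shows "tensor_map scale m g A \<in> Units (tensor_power scale m)"
    and "tensor_map scale m g (inv\<^bsub>tensor_power scale n\<^esub> A) = inv\<^bsub>tensor_power scale m\<^esub> (tensor_map scale m g A)"
  using hom_Units[OF tensor_power_monoid tensor_power_monoid tensor_map_hom[OF assms(1)]
      tensor_map_one[OF assms(1)] assms(2)] by blast+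

lemma length_3_cases:
  assumes "length xs = 3"
  obtains a b c where "xs = [a, b, c]"
  using assms by (auto simp: numeral_3_eq_3 length_Suc_conv)

lemma replicate_2: "replicate 2 x = [x, x]"
  by (simp add: numeral_2_eq_2)

lemma length_2_cases:
  assumes "length xs = 2"
  obtains a b where "xs = [a, b]"
  using assms by (auto simp: numeral_2_eq_2 length_Suc_conv)

abbreviation perm_entries :: "nat list \<Rightarrow> 'h list \<Rightarrow> 'h list"
  where "perm_entries p xs \<equiv> map (\<lambda>i. xs ! (i - 1)) p"

text \<open>
  The hypothesis \<open>sort p = [1, 2, 3]\<close> says that \<open>p\<close> is a permutation, in a form that rewriting decides for
  concrete lists.
\<close>

lemma perm3:
  assumes "sort p = [1, 2, 3]"
  shows "placement 3 3 (perm_entries p)" "perm scale p = tensor_map scale 3 (perm_entries p)"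
proof -
  have "set p = {1, 2, 3}" using arg_cong[OF assms, of set] by simp
  moreover have "{1..3::nat} = {1, 2, 3}" by auto
  moreover have "distinct p" using arg_cong[OF assms, of distinct] by simp
  moreover have "length p = 3" using arg_cong[OF assms, of length] by simp
  ultimately show "placement 3 3 (perm_entries p)" "perm scale p = tensor_map scale 3 (perm_entries p)"
    using placement_perm[of p 3] by (simp_all add: perm_def fun_eq_iff)
qed

lemma perm_comp:
  assumes p: "sort p = [1, 2, 3]" and q: "sort q = [1, 2, 3]" and A: "A \<in> carrier (tensor_power scale 3)"
  shows "perm scale q (perm scale p A) = perm scale (map (\<lambda>i. p ! (i - 1)) q) A"
proof -
  have len: "length p = 3" "length q = 3"
    using arg_cong[OF p, of length] arg_cong[OF q, of length] by simp_all
  have q_set: "set q = {1, 2, 3}" using arg_cong[OF q, of set] by simp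
  have entries: "perm_entries q (perm_entries p xs) = perm_entries (map (\<lambda>i. p ! (i - 1)) q) xs"
    for xs :: "'h list"
    using len q_set by auto
  have "perm scale q (perm scale p A) = tensor_map scale 3 (perm_entries (map (\<lambda>i. p ! (i - 1)) q)) A"
    unfolding perm3(2)[OF p] perm3(2)[OF q]
    by (rule tensor_map_comp[OF perm3(1)[OF p] A perm3(1)[OF q]])
      (rule entries)
  then show ?thesis
    by (simp add: perm_def[of scale "map _ _"] len)
qed

lemma perm_identity:
  assumes A: "A \<in> carrier (tensor_power scale 3)"
  shows "perm scale [1, 2, 3] A = A"
proof -
  have "perm scale [1, 2, 3] A = tensor_map scale 3 (\<lambda>xs. xs) A"
    by (subst perm3(2), simp, rule tensor_map_cong[OF A]) (erule length_3_cases, simp)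
  also have "\<dots> = A"
    using A by (simp add: tensor_map_def tensor_class_rep flip: formal_expansion)
  finally show ?thesis .
qed

lemma perm_compositions:
  assumes A: "A \<in> carrier (tensor_power scale 3)"
  shows "perm scale [1, 3, 2] (perm scale [1, 3, 2] A) = A"
    and "perm scale [1, 3, 2] (perm scale [2, 1, 3] A) = perm scale [2, 3, 1] A"
    and "perm scale [3, 1, 2] (perm scale [2, 1, 3] A) = perm scale [3, 2, 1] A"
    and "perm scale [2, 1, 3] (perm scale [1, 3, 2] A) = perm scale [3, 1, 2] A"
    and "perm scale [1, 3, 2] (perm scale [3, 1, 2] A) = perm scale [3, 2, 1] A"
    and "perm scale [2, 1, 3] (perm scale [2, 3, 1] A) = perm scale [3, 2, 1] A"
    and "perm scale [2, 1, 3] (perm scale [3, 1, 2] A) = perm scale [1, 3, 2] A"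
proof -
  note comp = perm_comp[OF _ _ A]
  show "perm scale [1, 3, 2] (perm scale [1, 3, 2] A) = A"
    using comp[of "[1, 3, 2]" "[1, 3, 2]"] perm_identity[OF A] by simp
  show "perm scale [1, 3, 2] (perm scale [2, 1, 3] A) = perm scale [2, 3, 1] A"
    using comp[of "[2, 1, 3]" "[1, 3, 2]"] by simp
  show "perm scale [3, 1, 2] (perm scale [2, 1, 3] A) = perm scale [3, 2, 1] A"
    using comp[of "[2, 1, 3]" "[3, 1, 2]"] by simp
  show "perm scale [2, 1, 3] (perm scale [1, 3, 2] A) = perm scale [3, 1, 2] A"
    using comp[of "[1, 3, 2]" "[2, 1, 3]"] by simp
  show "perm scale [1, 3, 2] (perm scale [3, 1, 2] A) = perm scale [3, 2, 1] A"
    using comp[of "[3, 1, 2]" "[1, 3, 2]"] by simp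
  show "perm scale [2, 1, 3] (perm scale [2, 3, 1] A) = perm scale [3, 2, 1] A"
    using comp[of "[2, 3, 1]" "[2, 1, 3]"] by simp
  show "perm scale [2, 1, 3] (perm scale [3, 1, 2] A) = perm scale [1, 3, 2] A"
    using comp[of "[3, 1, 2]" "[2, 1, 3]"] by simp
qed

lemma
  assumes p: "sort p = [1, 2, 3]"
  shows perm3_hom: "perm scale p \<in> hom (tensor_power scale 3) (tensor_power scale 3)"
    and perm3_Units: "A \<in> Units (tensor_power scale 3) \<Longrightarrow> perm scale p A \<in> Units (tensor_power scale 3)"
    and perm3_inv: "A \<in> Units (tensor_power scale 3) \<Longrightarrow>
      perm scale p (inv\<^bsub>tensor_power scale 3\<^esub> A) = inv\<^bsub>tensor_power scale 3\<^esub> (perm scale p A)"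
  unfolding perm3(2)[OF p] using perm3(1)[OF p]
  by (simp_all add: tensor_map_hom tensor_map_Units)

lemma leg12_insert_at:
  "A \<in> carrier (tensor_power scale 2) \<Longrightarrow> leg12 scale A = tensor_map scale 3 (insert_at 1 (replicate 2 1)) A"
  unfolding leg12_def
  by (rule tensor_map_cong) (auto elim!: length_2_cases simp: insert_at_def replicate_2)

lemma leg23_insert_at:
  "A \<in> carrier (tensor_power scale 2) \<Longrightarrow> leg23 scale A = tensor_map scale 3 (insert_at 2 (replicate 2 1)) A"
  unfolding leg23_def
  by (rule tensor_map_cong) (auto elim!: length_2_cases simp: insert_at_def replicate_2)

lemma placement_legs:
  "placement 2 3 (insert_at 1 (replicate 2 (1::'h)))" "placement 2 3 (insert_at 2 (replicate 2 (1::'h)))"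
  using placement_insert_ones[of 1 2] placement_insert_ones[of 2 2] by simp_all

text \<open>
  All legs are permutations of the first one.  So gauge formulas need to be established only for a
  single leg.
\<close>

lemma perm_leg12:
  assumes A: "A \<in> carrier (tensor_power scale 2)"
  shows "perm scale [1, 3, 2] (leg12 scale A) = leg13 scale A"
    and "perm scale [3, 1, 2] (leg12 scale A) = leg23 scale A"
    and "perm scale [2, 1, 3] (leg12 scale A) = leg12 scale (perm scale [2, 1] A)"
proof -
  note comp = tensor_map_comp[OF placement_legs(1) A perm3(1)]
  have entries: "insert_at 1 (replicate 2 1) xs = [xs ! 0, xs ! 1, 1]" if "length xs = 2" for xs :: "'h list"
    using that by (auto elim!: length_2_cases simp: insert_at_def replicate_2)
  show "perm scale [1, 3, 2] (leg12 scale A) = leg13 scale A"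
    unfolding leg12_insert_at[OF A] leg13_def
    by (subst perm3(2), simp, rule comp) (simp_all only: entries, simp_all)
  show "perm scale [3, 1, 2] (leg12 scale A) = leg23 scale A"
    unfolding leg12_insert_at[OF A] leg23_def
    by (subst perm3(2), simp, rule comp) (simp_all only: entries, simp_all)
  have flip: "placement 2 2 (perm_entries [2, 1])"
    by (rule placement_perm) auto
  have flip_A: "perm scale [2, 1] A = tensor_map scale 2 (perm_entries [2, 1]) A"
    by (simp add: perm_def numeral_2_eq_2)
  have "leg12 scale (perm scale [2, 1] A) =
      tensor_map scale 3 (insert_at 1 (replicate 2 1)) (tensor_map scale 2 (perm_entries [2, 1]) A)"
    unfolding flip_A by (rule leg12_insert_at) (rule hom_in_carrier[OF tensor_map_hom[OF flip] A])
  also have "\<dots> = tensor_map scale 3 (\<lambda>xs. [xs ! 1, xs ! 0, 1]) A"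
    by (rule tensor_map_comp[OF flip A placement_legs(1)]) (simp add: insert_at_def replicate_2)
  also have "\<dots> = perm scale [2, 1, 3] (leg12 scale A)"
    unfolding leg12_insert_at[OF A]
    by (subst perm3(2), simp, rule comp[symmetric]) (simp_all only: entries, simp_all)
  finally show "perm scale [2, 1, 3] (leg12 scale A) = leg12 scale (perm scale [2, 1] A)" ..
qed

lemma perm_flip_closed:
  assumes "A \<in> carrier (tensor_power scale 2)"
  shows "perm scale [2, 1] A \<in> carrier (tensor_power scale 2)"
proof -
  have "placement 2 2 (perm_entries [2, 1])"
    by (rule placement_perm) auto
  from hom_in_carrier[OF tensor_map_hom[OF this] assms] show ?thesis
    by (simp add: perm_def numeral_2_eq_2)
qed

lemma perm_legs:
  assumes A: "A \<in> carrier (tensor_power scale 2)"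
  shows "perm scale [2, 1, 3] (leg13 scale A) = leg23 scale A"
    and "perm scale [2, 1, 3] (leg23 scale A) = leg13 scale A"
    and "perm scale [1, 3, 2] (leg13 scale A) = leg12 scale A"
proof -
  have "leg12 scale A \<in> carrier (tensor_power scale 3)"
    unfolding leg12_insert_at[OF A] using A by (rule hom_in_carrier[OF tensor_map_hom[OF placement_legs(1)]])
  then show "perm scale [2, 1, 3] (leg13 scale A) = leg23 scale A"
    "perm scale [2, 1, 3] (leg23 scale A) = leg13 scale A"
    "perm scale [1, 3, 2] (leg13 scale A) = leg12 scale A"
    unfolding perm_leg12(1,2)[OF A, symmetric] by (simp_all only: perm_compositions)
qed

lemma
  shows leg12_closed: "A \<in> carrier (tensor_power scale 2) \<Longrightarrow> leg12 scale A \<in> carrier (tensor_power scale 3)"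
    and leg12_mult: "\<lbrakk>A \<in> carrier (tensor_power scale 2); B \<in> carrier (tensor_power scale 2)\<rbrakk> \<Longrightarrow>
      leg12 scale (A \<otimes>\<^bsub>tensor_power scale 2\<^esub> B) = leg12 scale A \<otimes>\<^bsub>tensor_power scale 3\<^esub> leg12 scale B"
    and leg12_Units: "A \<in> Units (tensor_power scale 2) \<Longrightarrow> leg12 scale A \<in> Units (tensor_power scale 3)"
    and leg12_inv: "A \<in> Units (tensor_power scale 2) \<Longrightarrow>
      leg12 scale (inv\<^bsub>tensor_power scale 2\<^esub> A) = inv\<^bsub>tensor_power scale 3\<^esub> (leg12 scale A)"
proof -
  interpret H2: Group.monoid "tensor_power scale 2" by (rule tensor_power_monoid)
  note hom = tensor_map_hom[OF placement_legs(1)]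
  show "A \<in> carrier (tensor_power scale 2) \<Longrightarrow> leg12 scale A \<in> carrier (tensor_power scale 3)"
    by (simp only: leg12_insert_at hom_in_carrier[OF hom])
  show "\<lbrakk>A \<in> carrier (tensor_power scale 2); B \<in> carrier (tensor_power scale 2)\<rbrakk> \<Longrightarrow>
      leg12 scale (A \<otimes>\<^bsub>tensor_power scale 2\<^esub> B) = leg12 scale A \<otimes>\<^bsub>tensor_power scale 3\<^esub> leg12 scale B"
    by (simp only: leg12_insert_at hom_mult[OF hom] H2.m_closed)
  show "A \<in> Units (tensor_power scale 2) \<Longrightarrow> leg12 scale A \<in> Units (tensor_power scale 3)"
    by (simp only: leg12_insert_at H2.Units_closed tensor_map_Units[OF placement_legs(1)])
  show "A \<in> Units (tensor_power scale 2) \<Longrightarrow>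
      leg12 scale (inv\<^bsub>tensor_power scale 2\<^esub> A) = inv\<^bsub>tensor_power scale 3\<^esub> (leg12 scale A)"
    by (simp only: leg12_insert_at H2.Units_closed H2.Units_inv_closed tensor_map_Units[OF placement_legs(1)])
qed

end

section \<open>The quasi-dynamical Yang--Baxter equation\<close>

context quasi_triangular_quasi_hopf_algebra
begin

lemma R12_comult:
  assumes "A \<in> carrier (tensor_power scale 2)"
  shows "leg12 scale \<R> \<otimes>\<^bsub>tensor_power scale 3\<^esub> apply_at scale 2 1 \<Delta> A =
    perm scale [2, 1, 3] (apply_at scale 2 1 \<Delta> A) \<otimes>\<^bsub>tensor_power scale 3\<^esub> leg12 scale \<R>"
proof -
  have p: "sort [2, 1, 3::nat] = [1, 2, 3]" by simp
  have "\<R> \<in> carrier (tensor_power scale 2)" using R_invertible by (simp add: Units_def)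
  moreover have "perm_entries [2, 1, 3] (insert_at 1 xs [d, e]) = insert_at 1 xs [e, d]"
    if "length xs = 2" for xs :: "'h list" and d e
    using that by (auto elim!: length_2_cases simp: insert_at_def)
  ultimately show ?thesis
    using R_comult_at[of 1 2 "perm_entries [2, 1, 3]" A] assms perm3(1)[OF p]
    unfolding perm3(2)[OF p] by (simp add: leg12_insert_at del: One_nat_def)
qed

lemma R23_comult:
  assumes "A \<in> carrier (tensor_power scale 2)"
  shows "leg23 scale \<R> \<otimes>\<^bsub>tensor_power scale 3\<^esub> apply_at scale 2 2 \<Delta> A =
    perm scale [1, 3, 2] (apply_at scale 2 2 \<Delta> A) \<otimes>\<^bsub>tensor_power scale 3\<^esub> leg23 scale \<R>"
proof -
  have p: "sort [1, 3, 2::nat] = [1, 2, 3]" by simp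
  have "\<R> \<in> carrier (tensor_power scale 2)" using R_invertible by (simp add: Units_def)
  moreover have "perm_entries [1, 3, 2] (insert_at 2 xs [d, e]) = insert_at 2 xs [e, d]"
    if "length xs = 2" for xs :: "'h list" and d e
    using that by (auto elim!: length_2_cases simp: insert_at_def)
  ultimately show ?thesis
    using R_comult_at[of 2 2 "perm_entries [1, 3, 2]" A] assms perm3(1)[OF p]
    unfolding perm3(2)[OF p] by (simp add: leg23_insert_at del: One_nat_def)
qed

lemma apply_at_Units:
  assumes "A \<in> Units (tensor_power scale 2)" "1 \<le> i" "i \<le> 2"
  shows "apply_at scale 2 i \<Delta> A \<in> Units (tensor_power scale 3)"
  using hom_Units(1)[OF tensor_power_monoid tensor_power_monoid apply_at_hom[OF assms(2,3)]
    apply_at_one[OF assms(2,3)] assms(1)] by simp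

context
  fixes H3 (structure)
  assumes H3: "H3 = tensor_power scale 3"
begin

interpretation H3: Group.monoid H3 unfolding H3 by (rule tensor_power_monoid)
interpretation H2: Group.monoid "tensor_power scale 2" by (rule tensor_power_monoid)

lemmas perm_H3 = perm3_Units[folded H3] perm3_inv[folded H3] hom_mult[OF perm3_hom, folded H3]
  hom_in_carrier[OF perm3_hom, folded H3]

lemma legs_closed:
  assumes A: "A \<in> carrier (tensor_power scale 2)"
  shows "leg12 scale A \<in> carrier H3" "leg13 scale A \<in> carrier H3" "leg23 scale A \<in> carrier H3"
proof -
  show leg12: "leg12 scale A \<in> carrier H3" using A leg12_closed by (simp add: H3)
  then show "leg13 scale A \<in> carrier H3" "leg23 scale A \<in> carrier H3"
    unfolding perm_leg12(1,2)[OF A, symmetric] by (simp_all add: perm_H3)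
qed

lemma R_closed: "\<R> \<in> carrier (tensor_power scale 2)"
  using R_invertible by (rule H2.Units_closed)

lemma coassociator_Units: "\<Phi> \<in> Units H3"
  using coassociator_invertible by (simp add: H3)

text \<open>
  The left-hand side is \<open>\<R>\<^sub>1\<^sub>2 (\<Delta> \<otimes> 1)\<R>\<close> and the right-hand side is \<open>(\<Delta>\<^sup>T \<otimes> 1)\<R> \<R>\<^sub>1\<^sub>2\<close>, both with the
  hexagon formula inserted; they agree because \<open>\<R>\<close> intertwines \<open>\<Delta>\<close> and \<open>\<Delta>\<^sup>T\<close>.
\<close>

lemma quasi_yang_baxter:
  "leg12 scale \<R> \<otimes> inv (perm scale [2, 3, 1] \<Phi>) \<otimes> leg13 scale \<R> \<otimes> perm scale [1, 3, 2] \<Phi> \<otimes>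
      leg23 scale \<R> \<otimes> inv \<Phi> =
    inv (perm scale [3, 2, 1] \<Phi>) \<otimes> leg23 scale \<R> \<otimes> perm scale [3, 1, 2] \<Phi> \<otimes> leg13 scale \<R> \<otimes>
      inv (perm scale [2, 1, 3] \<Phi>) \<otimes> leg12 scale \<R>"
proof -
  note closed = legs_closed[OF R_closed] coassociator_Units H3.Units_closed[OF coassociator_Units] perm_H3
  have "leg12 scale \<R> \<otimes> apply_at scale 2 1 \<Delta> \<R> =
      leg12 scale \<R> \<otimes> inv (perm scale [2, 3, 1] \<Phi>) \<otimes> leg13 scale \<R> \<otimes> perm scale [1, 3, 2] \<Phi> \<otimes>
      leg23 scale \<R> \<otimes> inv \<Phi>"
    unfolding R_hexagon_left[folded H3] by (simp add: closed H3.m_assoc)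
  moreover have "perm scale [2, 1, 3] (apply_at scale 2 1 \<Delta> \<R>) =
      inv (perm scale [3, 2, 1] \<Phi>) \<otimes> leg23 scale \<R> \<otimes> perm scale [3, 1, 2] \<Phi> \<otimes> leg13 scale \<R> \<otimes>
      inv (perm scale [2, 1, 3] \<Phi>)"
    unfolding R_hexagon_left[folded H3]
    by (simp add: closed perm_legs[OF R_closed] perm_compositions[folded H3] del: One_nat_def)
  ultimately show ?thesis
    using R12_comult[OF R_closed, folded H3] by simp
qed

lemma perm_gauge:
  assumes "sort p = [1, 2, 3]" "a \<in> carrier H3" "x \<in> carrier H3" "b \<in> Units H3"
  shows "perm scale p (a \<otimes> x \<otimes> inv b) = perm scale p a \<otimes> perm scale p x \<otimes> inv (perm scale p b)"
  using assms by (simp add: perm_H3)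

text \<open>
  The shift enters only through the element \<open>G\<close>, the shifted twist with subscript 23, and through \<open>RG\<close>,
  the shifted \<open>R\<close>-matrix that it defines.  Every factor of the equation is a gauge transform by
  permutations of \<open>L\<close> and \<open>K\<close> of the corresponding untwisted factor, and the gauge factors telescope.
\<close>

lemma dynamical_yang_baxter:
  assumes F: "F \<in> Units (tensor_power scale 2)" and G: "G \<in> Units H3"
    and cocycle: "leg12 scale F \<otimes> apply_at scale 2 1 \<Delta> F \<otimes> \<Phi> = \<Phi> \<otimes> G \<otimes> apply_at scale 2 2 \<Delta> F"
    and RF: "RF = perm scale [2, 1] F \<otimes>\<^bsub>tensor_power scale 2\<^esub> \<R> \<otimes>\<^bsub>tensor_power scale 2\<^esub>
      inv\<^bsub>tensor_power scale 2\<^esub> F"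
    and RG: "RG = perm scale [1, 3, 2] G \<otimes> leg23 scale \<R> \<otimes> inv G"
  shows "perm scale [1, 3, 2] (perm scale [2, 1, 3] RG) \<otimes> inv (perm scale [2, 3, 1] \<Phi>) \<otimes> leg13 scale RF \<otimes>
      perm scale [1, 3, 2] \<Phi> \<otimes> RG \<otimes> inv \<Phi> =
    inv (perm scale [3, 2, 1] \<Phi>) \<otimes> leg23 scale RF \<otimes> perm scale [3, 1, 2] \<Phi> \<otimes>
      perm scale [2, 1, 3] RG \<otimes> inv (perm scale [2, 1, 3] \<Phi>) \<otimes> leg12 scale RF"
proof -
  define A where "A = apply_at scale 2 1 \<Delta> F"
  define B where "B = apply_at scale 2 2 \<Delta> F"
  define L where "L = leg12 scale F \<otimes> A"
  define K where "K = G \<otimes> B"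
  note F_closed = H2.Units_closed[OF F]
  have A: "A \<in> Units H3" and B: "B \<in> Units H3"
    unfolding A_def B_def H3 using F by (simp_all add: apply_at_Units)
  have F12: "leg12 scale F \<in> Units H3"
    using leg12_Units[OF F] by (simp add: H3)
  have L: "L \<in> Units H3" and K: "K \<in> Units H3"
    using F12 A G B by (simp_all add: L_def K_def)
  note closed = legs_closed[OF R_closed] coassociator_Units A B F12 L K G perm_H3 H3.Units_closed
  have LK: "L \<otimes> \<Phi> = \<Phi> \<otimes> K"
    using cocycle[folded A_def B_def] by (simp add: L_def K_def closed H3.m_assoc)

  \<comment> \<open>The unshifted matrices are gauged by permutations of \<open>L\<close>.\<close>
  have flip_F: "perm scale [2, 1] F \<in> carrier (tensor_power scale 2)"
    by (rule perm_flip_closed[OF F_closed])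
  have RF_closed: "RF \<in> carrier (tensor_power scale 2)"
    using flip_F F R_closed by (simp add: RF)
  have "leg12 scale RF = perm scale [2, 1, 3] (leg12 scale F) \<otimes> leg12 scale \<R> \<otimes> inv (leg12 scale F)"
    unfolding RF H3 using flip_F F F_closed R_closed
    by (simp add: leg12_mult leg12_inv perm_leg12(3) del: One_nat_def)
  also have "\<dots> = (perm scale [2, 1, 3] (leg12 scale F) \<otimes> perm scale [2, 1, 3] A) \<otimes> leg12 scale \<R> \<otimes> inv L"
    unfolding L_def
    by (rule H3.gauge_absorb) (use R12_comult[OF F_closed, folded H3 A_def] in \<open>simp_all add: closed\<close>)
  finally have R12: "leg12 scale RF = perm scale [2, 1, 3] L \<otimes> leg12 scale \<R> \<otimes> inv L"
    by (simp add: L_def closed)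
  have R13: "leg13 scale RF = perm scale [2, 3, 1] L \<otimes> leg13 scale \<R> \<otimes> inv (perm scale [1, 3, 2] L)"
    unfolding perm_leg12(1)[OF RF_closed, symmetric] R12
    by (subst perm_gauge)
      (simp_all add: closed perm_compositions[folded H3] perm_leg12[OF R_closed] del: One_nat_def)
  have R23: "leg23 scale RF = perm scale [3, 2, 1] L \<otimes> leg23 scale \<R> \<otimes> inv (perm scale [3, 1, 2] L)"
    unfolding perm_leg12(2)[OF RF_closed, symmetric] R12
    by (subst perm_gauge)
      (simp_all add: closed perm_compositions[folded H3] perm_leg12[OF R_closed] del: One_nat_def)

  \<comment> \<open>The shifted matrices are gauged by permutations of \<open>K\<close>.\<close>
  have "RG = (perm scale [1, 3, 2] G \<otimes> perm scale [1, 3, 2] B) \<otimes> leg23 scale \<R> \<otimes> inv K"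
    unfolding RG K_def
    by (rule H3.gauge_absorb) (use R23_comult[OF F_closed, folded H3 B_def] in \<open>simp_all add: closed\<close>)
  then have R23_shift: "RG = perm scale [1, 3, 2] K \<otimes> leg23 scale \<R> \<otimes> inv K"
    by (simp add: K_def closed)
  have R13_shift: "perm scale [2, 1, 3] RG = perm scale [3, 1, 2] K \<otimes> leg13 scale \<R> \<otimes> inv (perm scale [2, 1, 3] K)"
    unfolding R23_shift
    by (subst perm_gauge)
      (simp_all add: closed perm_compositions[folded H3] perm_legs[OF R_closed] del: One_nat_def)
  have R12_shift: "perm scale [1, 3, 2] (perm scale [2, 1, 3] RG) =
      perm scale [3, 2, 1] K \<otimes> leg12 scale \<R> \<otimes> inv (perm scale [2, 3, 1] K)"
    unfolding R13_shift
    by (subst perm_gauge)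
      (simp_all add: closed perm_compositions[folded H3] perm_legs[OF R_closed] del: One_nat_def)

  \<comment> \<open>The permuted coassociators pass between the gauges by \<open>K\<close> and by \<open>L\<close>.\<close>
  have perm_LK: "perm scale p L \<otimes> perm scale p \<Phi> = perm scale p \<Phi> \<otimes> perm scale p K"
    if "sort p = [1, 2, 3]" for p
    using arg_cong[OF LK, of "perm scale p"] that by (simp add: closed)
  have \<Phi>_perm: "perm scale p \<Phi> = perm scale p L \<otimes> perm scale p \<Phi> \<otimes> inv (perm scale p K)"
    and \<Phi>_perm_inv: "inv (perm scale p \<Phi>) = perm scale p K \<otimes> inv (perm scale p \<Phi>) \<otimes> inv (perm scale p L)"
    if "sort p = [1, 2, 3]" for p
    using H3.gauge_inv[OF perm_LK[OF that]] that by (simp_all add: closed)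
  have \<Phi>_inv: "inv \<Phi> = K \<otimes> inv \<Phi> \<otimes> inv L"
    using H3.gauge_inv(2)[OF LK] by (simp add: closed)

  \<comment> \<open>The rule for each factor determines the intermediate gauge factors, which then cancel.\<close>
  have "perm scale [1, 3, 2] (perm scale [2, 1, 3] RG) \<otimes> inv (perm scale [2, 3, 1] \<Phi>) \<otimes> leg13 scale RF \<otimes>
      perm scale [1, 3, 2] \<Phi> \<otimes> RG \<otimes> inv \<Phi> =
    perm scale [3, 2, 1] K \<otimes>
      (leg12 scale \<R> \<otimes> inv (perm scale [2, 3, 1] \<Phi>) \<otimes> leg13 scale \<R> \<otimes> perm scale [1, 3, 2] \<Phi> \<otimes>
       leg23 scale \<R> \<otimes> inv \<Phi>) \<otimes> inv L"
    by (rule H3.gauge_mult R12_shift \<Phi>_perm_inv R13 \<Phi>_perm R23_shift \<Phi>_inv | simp add: closed)+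
  moreover have "inv (perm scale [3, 2, 1] \<Phi>) \<otimes> leg23 scale RF \<otimes> perm scale [3, 1, 2] \<Phi> \<otimes>
      perm scale [2, 1, 3] RG \<otimes> inv (perm scale [2, 1, 3] \<Phi>) \<otimes> leg12 scale RF =
    perm scale [3, 2, 1] K \<otimes>
      (inv (perm scale [3, 2, 1] \<Phi>) \<otimes> leg23 scale \<R> \<otimes> perm scale [3, 1, 2] \<Phi> \<otimes> leg13 scale \<R> \<otimes>
       inv (perm scale [2, 1, 3] \<Phi>) \<otimes> leg12 scale \<R>) \<otimes> inv L"
    by (rule H3.gauge_mult R13_shift \<Phi>_perm_inv R23 \<Phi>_perm R12 | simp add: closed)+
  ultimately show ?thesis
    by (simp only: quasi_yang_baxter)
qed

end

end

text \<open>
  Being compatible with products, inverses and the flip, and leaving \<open>\<R>\<close> unchanged, the shift can be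
  carried out in \<open>F\<close> alone.
\<close>

lemma (in argument_shift) shift_twisted_R:
  assumes R: "\<R> \<in> carrier (tensor_power scale 2)"
    and F: "F \<in> \<A>" "\<And>l. l \<in> D \<Longrightarrow> F l \<in> Units (tensor_power scale 2)"
    and F_inv: "(\<lambda>l. inv\<^bsub>tensor_power scale 2\<^esub> (F l)) \<in> \<A>" and l: "l \<in> D"
  shows "shift h (twisted_R scale \<R> F) l =
    perm scale [1, 3, 2] (shift h F l) \<otimes>\<^bsub>tensor_power scale 3\<^esub> leg23 scale \<R> \<otimes>\<^bsub>tensor_power scale 3\<^esub>
      inv\<^bsub>tensor_power scale 3\<^esub> (shift h F l)"
proof -
  note flip = flip_family[OF F(1)] and const = const_family[OF R]
  show ?thesis
    unfolding twisted_R_def[abs_def]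
    by (simp only: shift_mult[OF mult_family[OF flip const] F_inv l] shift_mult[OF flip const l]
        shift_flip[OF F(1) l] shift_const[OF R l] shift_inv[OF F F_inv l])
qed

theorem proposition10:
  fixes scale :: "'k::field \<Rightarrow> 'h::ring_1 \<Rightarrow> 'h"
    and \<Delta> :: "'h \<Rightarrow> ('k, 'h) tensor"
    and \<epsilon> :: "'h \<Rightarrow> 'k"
    and \<Phi> \<R> :: "('k, 'h) tensor"
    and S :: "'h \<Rightarrow> 'h"
    and \<alpha> \<beta> h :: 'h
    and D :: "'h set"
    and \<A> :: "('h \<Rightarrow> ('k, 'h) tensor) set"
    and shift :: "'h \<Rightarrow> ('h \<Rightarrow> ('k, 'h) tensor) \<Rightarrow> 'h \<Rightarrow> ('k, 'h) tensor"
    and F RF :: "'h \<Rightarrow> ('k, 'h) tensor"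
    and H3 (structure)
  assumes "quasi_triangular_quasi_hopf_algebra scale \<Delta> \<epsilon> \<Phi> S \<alpha> \<beta> \<R>"
    and "argument_shift scale h D \<A> shift"
    and H3: "H3 = tensor_power scale 3"
    and twist: "\<And>l. l \<in> D \<Longrightarrow> is_twist scale \<epsilon> (F l)"
    and shiftable: "F \<in> \<A>" "(\<lambda>l. inv\<^bsub>tensor_power scale 2\<^esub> (F l)) \<in> \<A>"
    and cocycle: "\<And>l. l \<in> D \<Longrightarrow>
      leg12 scale (F l) \<otimes> apply_at scale 2 1 \<Delta> (F l) \<otimes> \<Phi> =
      \<Phi> \<otimes> shift h F l \<otimes> apply_at scale 2 2 \<Delta> (F l)"
    and RF: "RF = twisted_R scale \<R> F"
    and "l \<in> D"
  shows
    "shifted12 scale shift h RF l \<otimes> inv (perm scale [2, 3, 1] \<Phi>) \<otimes> leg13 scale (RF l) \<otimes>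
     perm scale [1, 3, 2] \<Phi> \<otimes> shift h RF l \<otimes> inv \<Phi> =
     inv (perm scale [3, 2, 1] \<Phi>) \<otimes> leg23 scale (RF l) \<otimes> perm scale [3, 1, 2] \<Phi> \<otimes>
     shifted13 scale shift h RF l \<otimes> inv (perm scale [2, 1, 3] \<Phi>) \<otimes> leg12 scale (RF l)"
proof -
  interpret quasi_triangular_quasi_hopf_algebra scale \<Delta> \<epsilon> \<Phi> S \<alpha> \<beta> \<R> by fact
  interpret argument_shift scale h D \<A> shift by fact
  have F: "F l \<in> Units (tensor_power scale 2)" if "l \<in> D" for l
    using twist[OF that] by (simp add: is_twist_def)
  have R: "\<R> \<in> carrier (tensor_power scale 2)"
    using R_invertible by (simp add: Units_def)
  have "shift h F l \<in> Units H3"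
    unfolding H3 using shift_inv[OF shiftable(1) F shiftable(2) \<open>l \<in> D\<close>] by blast
  then show ?thesis
    unfolding shifted12_def shifted13_def
    by (intro dynamical_yang_baxter[OF H3 F[OF \<open>l \<in> D\<close>] _ cocycle[OF \<open>l \<in> D\<close>]])
      (simp_all only: RF twisted_R_def H3 shift_twisted_R[OF R shiftable(1) F shiftable(2) \<open>l \<in> D\<close>])
qed

end
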